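(* Let $A=R/I$, $R=k[x_1,x_2,x_3]$, be a graded Artinian level algebra of codimension $3$ with the Weak Lefschetz Property, and let $(h_0,h_1,\ldots,h_s)$ be its Hilbert function, $s$ the socle degree. Then (a) the Hilbert function is a strictly unimodal O-sequence $$h_0<h_1<\cdots<h_{r_1(A)}=\cdots=h_{\theta}>\cdots>h_{s-1}>h_s,$$ where $\theta=\min\{t:h_t>h_{t+1}\}$, such that the positive part of the first difference $(h_0,h_1-h_0,h_2-h_1,\dots)$ is an O-sequence; (b) $h_{d-1}-h_d<2(h_d-h_{d+1})$ for $s>d>\theta$; (c) $h_{s-1}\leq 3h_s$.
   Context: $k$ is an infinite field of characteristic $0$; $h_i=\dim_kA_i$, $A_s\ne0$. $A$ is level if its socle $\{a\in A:a\mathfrak m=0\}$ ($\mathfrak m$ the maximal homogeneous ideal) is concentrated in a single degree. $A$ has the Weak Lefschetz Property if there is $L\in A_1$ with each $\times L:A_i\to A_{i+1}$ ($1\le i\le s-1$) injective or surjective. An O-sequence is $(h_0=1,h_1,\dots)$ with $h_{i+1}\le h_i^{\langle i\rangle}$ for $i\ge1$, where for $h_i=\binom{m_i}{i}+\cdots+\binom{m_j}{j}$ ($m_i>\cdots>m_j\ge j\ge1$), $h_i^{\langle i\rangle}=\binom{m_i+1}{i+1}+\cdots+\binom{m_j+1}{j+1}$. $r_1(A)=\min\{\ell:(R/(I+(L)))_{\ell+1}=0\}$ for a general linear form $L$. *)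

theory Defs
  imports Complex_Main "HOL-Library.Poly_Mapping"
begin

type_synonym 'k mpoly = "(nat \<Rightarrow>\<^sub>0 nat) \<Rightarrow>\<^sub>0 'k"

definition mdeg :: "(nat \<Rightarrow>\<^sub>0 nat) \<Rightarrow> nat" where
  "mdeg m = (\<Sum>i\<in>Poly_Mapping.keys m. Poly_Mapping.lookup m i)"

definition R3 :: "'k::field mpoly set" where
  "R3 = {p. \<forall>m\<in>Poly_Mapping.keys p. Poly_Mapping.keys m \<subseteq> {0,1,2}}"

definition forms :: "nat \<Rightarrow> 'k::field mpoly set" where
  "forms d = {p \<in> R3. \<forall>m\<in>Poly_Mapping.keys p. mdeg m = d}"

definition Xvar :: "nat \<Rightarrow> 'k::field mpoly" where
  "Xvar i = Poly_Mapping.single (Poly_Mapping.single i 1) 1"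

definition hcomp :: "nat \<Rightarrow> 'k::field mpoly \<Rightarrow> 'k mpoly" where
  "hcomp d p = (\<Sum>m\<in>{m\<in>Poly_Mapping.keys p. mdeg m = d}. Poly_Mapping.single m (Poly_Mapping.lookup p m))"

definition pscale :: "'k::field \<Rightarrow> 'k mpoly \<Rightarrow> 'k mpoly" where
  "pscale c p = Poly_Mapping.map (\<lambda>x. c * x) p"

definition kdim :: "'k::field mpoly set \<Rightarrow> nat" where
  "kdim S = vector_space.dim pscale S"

definition is_ideal :: "'k::field mpoly set \<Rightarrow> bool" where
  "is_ideal I \<longleftrightarrow> I \<subseteq> R3 \<and> 0 \<in> I \<and> (\<forall>p\<in>I. \<forall>q\<in>I. p + q \<in> I) \<and>
     (\<forall>p\<in>I. \<forall>r\<in>R3. r * p \<in> I)"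

definition homogeneous_ideal :: "'k::field mpoly set \<Rightarrow> bool" where
  "homogeneous_ideal I \<longleftrightarrow> is_ideal I \<and> (\<forall>p\<in>I. \<forall>d. hcomp d p \<in> I)"

definition hilb :: "'k::field mpoly set \<Rightarrow> nat \<Rightarrow> nat" where
  "hilb I d = kdim (forms d :: 'k mpoly set) - kdim (I \<inter> forms d)"

definition artinian :: "'k::field mpoly set \<Rightarrow> bool" where
  "artinian I \<longleftrightarrow> (\<exists>N. \<forall>d\<ge>N. forms d \<subseteq> I)"

definition max_ideal :: "'k::field mpoly set" where
  "max_ideal = {p \<in> R3. Poly_Mapping.lookup p 0 = 0}"

text \<open>Level: the socle {a \<in> A. a m = 0} is concentrated in a single degree, i.e.
  every socle element is (mod I) a form of one fixed degree t.\<close>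
definition level :: "'k::field mpoly set \<Rightarrow> bool" where
  "level I \<longleftrightarrow> (\<exists>t. \<forall>f\<in>R3. (\<forall>p\<in>max_ideal. f * p \<in> I) \<longrightarrow>
                     (\<exists>g\<in>forms t. f - g \<in> I))"

definition mult_inj :: "'k::field mpoly set \<Rightarrow> 'k mpoly \<Rightarrow> nat \<Rightarrow> bool" where
  "mult_inj I L i \<longleftrightarrow> (\<forall>f\<in>forms i. L * f \<in> I \<longrightarrow> f \<in> I)"

definition mult_surj :: "'k::field mpoly set \<Rightarrow> 'k mpoly \<Rightarrow> nat \<Rightarrow> bool" where
  "mult_surj I L i \<longleftrightarrow> (\<forall>g\<in>forms (Suc i). \<exists>f\<in>forms i. g - L * f \<in> I)"

definition socle_degree :: "'k::field mpoly set \<Rightarrow> nat" where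
  "socle_degree I = (GREATEST s. hilb I s \<noteq> 0)"

definition WLP :: "'k::field mpoly set \<Rightarrow> bool" where
  "WLP I \<longleftrightarrow> (\<exists>L\<in>forms 1. \<forall>i. 1 \<le> i \<and> i \<le> socle_degree I - 1 \<longrightarrow>
                mult_inj I L i \<or> mult_surj I L i)"

definition linform :: "(nat \<Rightarrow> 'k::field) \<Rightarrow> 'k mpoly" where
  "linform a = (\<Sum>i<3. Poly_Mapping.single (Poly_Mapping.single i 1) (a i))"

definition peval :: "'k::field mpoly \<Rightarrow> (nat \<Rightarrow> 'k) \<Rightarrow> 'k" where
  "peval F a = (\<Sum>m\<in>Poly_Mapping.keys F. Poly_Mapping.lookup F m * (\<Prod>i\<in>Poly_Mapping.keys m. a i ^ Poly_Mapping.lookup m i))"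

text \<open>min{l. (R/(I+(L))) in degree l+1 = 0} for a given linear form L.\<close>
definition r1_at :: "'k::field mpoly set \<Rightarrow> 'k mpoly \<Rightarrow> nat" where
  "r1_at I L = (LEAST l. \<forall>p\<in>forms (Suc l). \<exists>q\<in>R3. p - L * q \<in> I)"

text \<open>r_1(A): the value of r1_at for a general linear form, i.e. for all L off a
  proper Zariski-closed subset of the space of linear forms.\<close>
definition r1 :: "'k::field mpoly set \<Rightarrow> nat" where
  "r1 I = (THE r. \<exists>F\<in>R3. F \<noteq> 0 \<and> (\<forall>a. peval F a \<noteq> 0 \<longrightarrow> r1_at I (linform a) = r))"

text \<open>Macaulay representation h = C(m_i,i)+...+C(m_j,j), m_i>...>m_j\<ge>j\<ge>1,
  encoded by the list [m_i, ..., m_j].\<close>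
definition mac_rep :: "nat \<Rightarrow> nat \<Rightarrow> nat list \<Rightarrow> bool" where
  "mac_rep i h ms \<longleftrightarrow> ms \<noteq> [] \<and> length ms \<le> i \<and> sorted_wrt (>) ms \<and>
     last ms \<ge> i + 1 - length ms \<and>
     h = (\<Sum>k<length ms. (ms ! k) choose (i - k))"

definition mac_upper :: "nat \<Rightarrow> nat \<Rightarrow> nat" where
  "mac_upper i h = (if h = 0 then 0 else
     (THE v. \<exists>ms. mac_rep i h ms \<and> v = (\<Sum>k<length ms. (ms ! k + 1) choose (i - k + 1))))"

definition O_sequence :: "(nat \<Rightarrow> nat) \<Rightarrow> bool" where
  "O_sequence h \<longleftrightarrow> h 0 = 1 \<and> (\<forall>i\<ge>1. h (Suc i) \<le> mac_upper i (h i))"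

text \<open>Positive part of the first difference (h_0, h_1-h_0, ...): truncated nat subtraction.\<close>
definition pos_diff :: "(nat \<Rightarrow> nat) \<Rightarrow> nat \<Rightarrow> nat" where
  "pos_diff h i = (if i = 0 then h 0 else h i - h (i - 1))"

end

theory Submission
  imports Defs "HOL-Computational_Algebra.Polynomial"
begin

text \<open>Let \<open>L\<close> be a Lefschetz element. Up to the first degree \<open>r\<close> in which \<open>h\<close> does not increase,
  multiplication by \<open>L\<close> is injective, and from there on it is surjective; hence the positive part of
  the first difference of \<open>h\<close> is the Hilbert function of \<open>R/(I + (L))\<close>, a quotient of a polynomial
  ring in two variables. For such quotients a value \<open>d i \<le> i\<close> forces \<open>d (i + 1) \<le> d i\<close>, and
  summing up shows that \<open>h\<close> itself is an O-sequence: it is compared with the Hilbert functions of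
  plane curves, so Macaulay's theorem in three variables is not needed. Surjectivity in degree \<open>r\<close>
  is an open condition on \<open>L\<close>, which identifies \<open>r\<close> with \<open>r1\<close>.

  For the decreasing part let \<open>K d\<close> be the kernel of \<open>L\<close> on \<open>A d\<close>, of dimension
  \<open>h d - h (d + 1)\<close>, and let \<open>y\<close>, \<open>z\<close> complete \<open>L\<close> to a basis of the linear forms. As \<open>A\<close> is level,
  \<open>(y, z)\<close> maps \<open>K (d - 1)\<close> injectively into \<open>K d \<times> K d\<close>. If this were a bijection, every
  \<open>u \<in> K d\<close> would be \<open>z v\<close> with \<open>y v = 0\<close> and \<open>y v'\<close> with \<open>z v' = 0\<close>, so that \<open>u\<close> would lie in
  the socle. In the same way \<open>A (s - 1)\<close> embeds into three copies of \<open>A s\<close>.\<close>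

section \<open>Macaulay representations\<close>

lemma mac_rep_single: "mac_rep i h [m] \<longleftrightarrow> 1 \<le> i \<and> i \<le> m \<and> h = m choose i"
  by (auto simp: mac_rep_def)

text \<open>The inductions on representations rest on this recursion: without its leading binomial,
  a representation in degree \<open>i\<close> is one of the remainder in degree
  \<open>i - 1\<close>.\<close>

lemma mac_rep_Cons:
  assumes "ms \<noteq> []"
  shows "mac_rep i h (m # ms) \<longleftrightarrow> 2 \<le> i \<and> hd ms < m \<and> m choose i \<le> h \<and>
           mac_rep (i - 1) (h - (m choose i)) ms"
proof -
  have sum: "(\<Sum>k<length (m # ms). (m # ms) ! k choose (i - k)) =
      (m choose i) + (\<Sum>k<length ms. ms ! k choose (i - 1 - k))"
    unfolding list.size add_Suc_right add_0_right
    by (subst sum.lessThan_Suc_shift) simp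
  have hd: "(\<forall>x\<in>set ms. x < m) \<longleftrightarrow> hd ms < m" if "sorted_wrt (>) ms"
    using that assms by (cases ms) auto
  have len: "1 \<le> length ms" using assms by (cases ms) auto
  have lst: "length ms < i \<Longrightarrow> i + 1 - length (m # ms) = i - 1 + 1 - length ms" by simp
  show ?thesis
    unfolding mac_rep_def sum using assms hd len lst by auto
qed

lemma mac_rep_le_hd:
  assumes "mac_rep i h ms"
  shows "i \<le> hd ms"
  using assms
proof (induction ms arbitrary: i h)
  case (Cons m ms)
  show ?case
  proof (cases "ms = []")
    case True
    then show ?thesis using Cons.prems by (simp add: mac_rep_single)
  next
    case False
    with Cons.prems have *: "2 \<le> i" "hd ms < m" "mac_rep (i - 1) (h - (m choose i)) ms"
      by (simp_all add: mac_rep_Cons)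
    from Cons.IH[OF *(3)] * show ?thesis by simp
  qed
qed (simp add: mac_rep_def)

text \<open>The head is the greedy choice. By Pascal's rule the gap between
  \<open>m choose i\<close> and \<open>(m + 1) choose i\<close> is \<open>m choose (i - 1)\<close>,
  and the terms after the head sum to less than this because the next entry is below
  \<open>m\<close>.\<close>

lemma mac_rep_bounds:
  assumes "mac_rep i h ms"
  shows "hd ms choose i \<le> h \<and> h < (hd ms + 1) choose i"
  using assms
proof (induction ms arbitrary: i h)
  case (Cons m ms)
  have pos: "1 \<le> i" "i \<le> m"
    using Cons.prems mac_rep_le_hd[OF Cons.prems] by (auto simp: mac_rep_def Suc_le_eq dest!: less_le_trans[of 0])
  then have pascal: "(m + 1) choose i = (m choose (i - 1)) + (m choose i)"
    by (cases i) simp_all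
  show ?case
  proof (cases "ms = []")
    case True
    then have "h = m choose i" using Cons.prems by (simp add: mac_rep_single)
    moreover have "0 < m choose (i - 1)" using pos by simp
    ultimately show ?thesis using pascal by simp
  next
    case False
    with Cons.prems have *: "hd ms < m" "m choose i \<le> h" "mac_rep (i - 1) (h - (m choose i)) ms"
      by (simp_all add: mac_rep_Cons)
    have "(hd ms + 1) choose (i - 1) \<le> m choose (i - 1)"
      using *(1) by (intro binomial_right_mono) simp
    with Cons.IH[OF *(3)] have "h - (m choose i) < m choose (i - 1)" by linarith
    then show ?thesis unfolding pascal list.sel using *(2) by linarith
  qed
qed (simp add: mac_rep_def)

lemma mac_rep_unique:
  assumes "mac_rep i h ms" "mac_rep i h ms'"
  shows "ms = ms'"
  using assms
proof (induction ms arbitrary: i h ms')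
  case (Cons m ms)
  from Cons.prems(2) obtain m' ns where ms': "ms' = m' # ns"
    by (cases ms') (auto simp: mac_rep_def)
  have le: "a \<le> b" if "a choose i \<le> h" "h < (b + 1) choose i" for a b
  proof (rule ccontr)
    assume "\<not> a \<le> b"
    then have "(b + 1) choose i \<le> a choose i" by (intro binomial_right_mono) simp
    with that show False by simp
  qed
  have [simp]: "m' = m"
    using mac_rep_bounds[OF Cons.prems(1)] mac_rep_bounds[OF Cons.prems(2)[unfolded ms']]
    by (auto intro!: antisym le)
  \<comment> \<open>Excludes that one list stops where the other continues: the remainder would be
    0.\<close>
  have zero: "\<not> mac_rep j 0 l" for j l
  proof
    assume "mac_rep j 0 l"
    then have "j \<le> hd l" "hd l choose j \<le> 0"
      using mac_rep_le_hd mac_rep_bounds by blast+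
    then show False by simp
  qed
  show ?case
    using Cons.prems Cons.IH[of "i - 1" "h - (m choose i)" ns] zero unfolding ms'
    by (cases "ms = []"; cases "ns = []") (auto simp: mac_rep_Cons mac_rep_single)
qed (simp add: mac_rep_def)

text \<open>Uniqueness of the representation lets the definite description be evaluated on any
  representation at hand.\<close>

lemma mac_upper_eqI:
  assumes "mac_rep i h ms"
  shows "mac_upper i h = (\<Sum>k<length ms. (ms ! k + 1) choose (i - k + 1))"
proof -
  have "0 < h"
    using mac_rep_le_hd[OF assms] mac_rep_bounds[OF assms] by (metis gr0I le_zero_eq binomial_eq_0_iff not_le)
  moreover have "(\<exists>ms. mac_rep i h ms \<and> v = (\<Sum>k<length ms. (ms ! k + 1) choose (i - k + 1))) \<longleftrightarrow>
      v = (\<Sum>k<length ms. (ms ! k + 1) choose (i - k + 1))" for v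
    using assms mac_rep_unique by blast
  ultimately show ?thesis
    unfolding mac_upper_def by simp
qed

text \<open>The Hilbert function of a plane curve of degree \<open>e\<close>, written as
  \<open>C(i+1,i) + C(i,i-1) + \<dots>\<close> (\<open>e\<close> terms).\<close>
definition curve_hilb :: "nat \<Rightarrow> nat \<Rightarrow> nat" where
  "curve_hilb i e = (\<Sum>k<e. i + 1 - k)"

text \<open>The first \<open>e\<close> binomials have the form \<open>C(n+1,n) = n+1\<close> and
  grow by one each when both indices are raised; the other \<open>f\<close> are
  \<open>C(n,n) = 1\<close> and stay. The condition \<open>e + f \<le> i\<close> keeps all lower
  indices positive.\<close>

lemma mac_upper_curve_hilb:
  assumes h: "h = curve_hilb i e + f" and "0 < h" "e + f \<le> i"
  shows "mac_upper i h = h + e"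
proof -
  define ms where "ms = map (\<lambda>k. if k < e then i + 1 - k else i - k) [0..<e + f]"
  have nth: "ms ! k = (if k < e then i + 1 - k else i - k)" if "k < e + f" for k
    using that by (simp add: ms_def)
  have len: "length ms = e + f" by (simp add: ms_def)
  have split: "(\<Sum>k<e + f. u k) = (\<Sum>k<e. u k) + (\<Sum>k\<in>{e..<e + f}. u k)" for u :: "nat \<Rightarrow> nat"
    by (metis ivl_disj_un_one(2) le_add1 finite_lessThan finite_atLeastLessThan ivl_disj_int_one(2) sum.union_disjoint)
  have choose1: "(i + 1 - k) choose (i - k) = i + 1 - k" if "k < e" for k
  proof -
    have "i + 1 - k = Suc (i - k)" using that \<open>e + f \<le> i\<close> by simp
    then show ?thesis by simp
  qed
  have choose2: "(i + 1 - k + 1) choose (i - k + 1) = i + 1 - k + 1" if "k < e" for k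
  proof -
    have "i + 1 - k + 1 = Suc (i - k + 1)" using that \<open>e + f \<le> i\<close> by simp
    then show ?thesis by simp
  qed
  have sum: "(\<Sum>k<length ms. ms ! k choose (i - k)) = h"
    unfolding len split h curve_hilb_def using nth choose1 by (simp add: sum.distrib)
  have upper: "(\<Sum>k<length ms. (ms ! k + 1) choose (i - k + 1)) = h + e"
  proof -
    have "(\<Sum>k<e. (ms ! k + 1) choose (i - k + 1)) = (\<Sum>k<e. (i + 1 - k) + 1)"
      using nth choose2 by (intro sum.cong) auto
    moreover have "(\<Sum>k\<in>{e..<e + f}. (ms ! k + 1) choose (i - k + 1)) = f"
      using nth by simp
    ultimately show ?thesis
      unfolding len split h curve_hilb_def sum.distrib by simp
  qed
  have "0 < e + f"
    using h \<open>0 < h\<close> by (cases "e = 0") (auto simp: curve_hilb_def)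
  moreover have "sorted_wrt (>) ms"
    unfolding sorted_wrt_iff_nth_less len using nth \<open>e + f \<le> i\<close> by auto
  moreover have "last ms \<ge> i + 1 - length ms"
  proof -
    have "last ms = ms ! (e + f - 1)"
      using len \<open>0 < e + f\<close> by (subst last_conv_nth) auto
    then show ?thesis using nth[of "e + f - 1"] \<open>0 < e + f\<close> len by auto
  qed
  ultimately have "mac_rep i h ms"
    unfolding mac_rep_def using sum len \<open>e + f \<le> i\<close> by auto
  then show ?thesis using mac_upper_eqI upper by simp
qed

lemma mac_upper_small:
  assumes "h \<le> i"
  shows "mac_upper i h = h"
proof (cases "h = 0")
  case False
  then show ?thesis using mac_upper_curve_hilb[of h i 0 h] assms by (simp add: curve_hilb_def)
qed (simp add: mac_upper_def)

lemma mac_upper_choose: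
  assumes "1 \<le> i" "i \<le> m"
  shows "mac_upper i (m choose i) = (m + 1) choose (i + 1)"
  using mac_upper_eqI[of i "m choose i" "[m]"] assms by (simp add: mac_rep_single)

lemma curve_hilb_Suc: "curve_hilb i (Suc e) = curve_hilb i e + (i + 1 - e)"
  by (simp add: curve_hilb_def)

lemma curve_hilb_Suc_Suc: "curve_hilb (Suc i) (Suc e) = i + 2 + curve_hilb i e"
proof -
  have "(\<Sum>k<Suc e. Suc i + 1 - k) = (Suc i + 1 - 0) + (\<Sum>k<e. Suc i + 1 - Suc k)"
    by (rule sum.lessThan_Suc_shift)
  then show ?thesis unfolding curve_hilb_def by simp
qed

text \<open>A curve of degree \<open>i + 1\<close> has no multiples in degree \<open>i\<close>, so
  the value is the number of ternary monomials of degree \<open>i\<close>.\<close>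

lemma curve_hilb_full: "curve_hilb i (i + 1) = (i + 2) choose i"
proof (induction i)
  case (Suc i)
  have "curve_hilb (Suc i) (Suc i + 1) = (i + 2) + curve_hilb i (i + 1)"
    using curve_hilb_Suc_Suc[of i "i + 1"] by simp
  then show ?case using Suc.IH by (simp add: binomial_symmetric[of "Suc i"] add.commute)
qed (simp add: curve_hilb_def)

lemma curve_hilb_mono: "e \<le> e' \<Longrightarrow> curve_hilb i e \<le> curve_hilb i e'"
  unfolding curve_hilb_def by (rule sum_mono2) auto

text \<open>For the largest \<open>e'\<close> with \<open>curve_hilb i e' \<le> h\<close>, the rest
  is smaller than the next term \<open>i + 1 - e'\<close>. So the representation has the shape
  treated above and permits growth by exactly \<open>e' \<ge> e\<close>. If \<open>h\<close> is the
  number of all ternary monomials, the growth is \<open>i + 2\<close>.\<close>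

lemma mac_upper_ge_curve:
  assumes "curve_hilb i e \<le> h" "e \<le> i + 1" "h \<le> (i + 2) choose i" "1 \<le> i"
  shows "h + e \<le> mac_upper i h"
proof (cases "h = (i + 2) choose i")
  case True
  have "mac_upper i h = (i + 3) choose (i + 1)"
    using mac_upper_choose[of i "i + 2"] assms True by (simp add: add.commute numeral_3_eq_3)
  also have "\<dots> = curve_hilb (i + 1) (i + 2)"
    using curve_hilb_full[of "i + 1"] by (simp add: eval_nat_numeral)
  also have "\<dots> = (i + 2) + curve_hilb i (i + 1)"
    using curve_hilb_Suc_Suc[of i "i + 1"] by simp
  finally show ?thesis using True assms curve_hilb_full[of i] by simp
next
  case False
  let ?Q = "\<lambda>x. x \<le> i + 1 \<and> curve_hilb i x \<le> h"
  define e' where "e' = (GREATEST x. ?Q x)"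
  have "?Q e" using assms by simp
  then have P: "?Q e'"
    unfolding e'_def by (rule GreatestI_nat[where b = "i + 1"]) simp
  have max: "x \<le> e'" if "?Q x" for x
    unfolding e'_def using that by (rule Greatest_le_nat[where b = "i + 1"]) simp
  have "e' \<noteq> i + 1"
    using P False assms curve_hilb_full[of i] by auto
  then have "e' \<le> i" using P by simp
  have "h < curve_hilb i (Suc e')"
    using max[of "Suc e'"] \<open>e' \<le> i\<close> by (auto simp: not_less[symmetric])
  then have f: "e' + (h - curve_hilb i e') \<le> i"
    using P \<open>e' \<le> i\<close> unfolding curve_hilb_Suc by simp
  show ?thesis
  proof (cases "h = 0")
    case True
    have "e = 0"
    proof (rule ccontr)
      assume "e \<noteq> 0"
      then have "curve_hilb i 1 \<le> curve_hilb i e" by (intro curve_hilb_mono) simp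
      moreover have "curve_hilb i 1 = i + 1" by (simp add: curve_hilb_def)
      ultimately show False using True assms by simp
    qed
    then show ?thesis using True by simp
  next
    case False
    then have "mac_upper i h = h + e'"
      using mac_upper_curve_hilb[of h i e' "h - curve_hilb i e'"] f P by simp
    with max[of e] assms show ?thesis by simp
  qed
qed

text \<open>The summand \<open>min (j + 1) e\<close> is the Hilbert function of two variables modulo
  one form of degree \<open>e\<close>, the first difference of that of the curve.\<close>

lemma curve_hilb_eq_sum:
  assumes "e \<le> i + 1"
  shows "curve_hilb i e = (\<Sum>j\<le>i. min (j + 1) e)"
  using assms
proof (induction e)
  case (Suc e)
  have "(\<Sum>j\<le>i. min (j + 1) (Suc e)) = (\<Sum>j\<le>i. min (j + 1) e + (if e \<le> j then 1 else 0))"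
    by (intro sum.cong) auto
  also have "\<dots> = (\<Sum>j\<le>i. min (j + 1) e) + card {j\<in>{..i}. e \<le> j}"
    by (simp add: sum.distrib sum.If_cases Int_def)
  also have "{j\<in>{..i}. e \<le> j} = {e..i}" by auto
  finally show ?case using Suc by (simp add: curve_hilb_Suc)
qed (simp add: curve_hilb_def)

section \<open>Numerical conditions on Hilbert functions in two variables, and their partial
  sums\<close>

locale binary_O_sequence =
  fixes d :: "nat \<Rightarrow> nat"
  assumes zero: "d 0 = 1"
    and le: "d i \<le> i + 1"
    and step: "d i \<le> i \<Longrightarrow> d (Suc i) \<le> d i"
begin

lemma O_seq: "O_sequence d"
  unfolding O_sequence_def
proof (intro conjI allI impI zero)
  fix i :: nat assume "1 \<le> i"
  show "d (Suc i) \<le> mac_upper i (d i)"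
  proof (cases "d i \<le> i")
    case True
    then show ?thesis using step mac_upper_small by simp
  next
    case False
    then have "d i = (i + 1) choose i" using le[of i] by simp
    then show ?thesis
      using mac_upper_choose[of i "i + 1"] \<open>1 \<le> i\<close> le[of "Suc i"] by simp
  qed
qed

text \<open>If \<open>d j \<le> j\<close>, the sequence does not increase from \<open>j\<close> on;
  otherwise \<open>d j = j + 1\<close>.\<close>

lemma ge_min:
  assumes "j \<le> i"
  shows "min (j + 1) (d i) \<le> d j"
proof (cases "d j \<le> j")
  case True
  have "d i \<le> d j \<and> d i \<le> i" using assms
  proof (induction rule: dec_induct)
    case (step n)
    then show ?case using binary_O_sequence.step[OF binary_O_sequence_axioms, of n] by simp
  qed (simp add: True)
  then show ?thesis by auto
next
  case False
  then show ?thesis by simp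
qed

text \<open>While \<open>h\<close> grows it is a partial sum of \<open>d\<close>, hence by
  \<open>ge_min\<close> at least the Hilbert function of a curve of degree \<open>d i\<close>.
  Macaulay's bound then allows growth by \<open>d i\<close>, and \<open>d (Suc i) \<le> d i\<close>
  unless \<open>d i = i + 1\<close>, when \<open>h i\<close> is as large as possible.\<close>

lemma O_seq_unimodal:
  assumes h0: "h 0 = 1"
    and inc: "\<And>i. i < r \<Longrightarrow> h (Suc i) = h i + d (Suc i)"
    and dec: "\<And>i. r \<le> i \<Longrightarrow> h (Suc i) \<le> h i"
  shows "O_sequence h"
  unfolding O_sequence_def
proof (intro conjI allI impI h0)
  have sum: "h i = (\<Sum>j\<le>i. d j)" if "i \<le> r" for i
    using that by (induction i) (auto simp: h0 zero inc)
  have full: "(\<Sum>j\<le>i. j + 1) = (i + 2) choose i" for i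
    using curve_hilb_eq_sum[of "i + 1" i] curve_hilb_full[of i] by simp
  have bound: "h i \<le> (i + 2) choose i" for i
  proof (cases "i \<le> r")
    case True
    have "(\<Sum>j\<le>i. d j) \<le> (\<Sum>j\<le>i. j + 1)" by (intro sum_mono le)
    with sum[OF True] full show ?thesis by simp
  next
    case False
    then have "r \<le> i" by simp
    then have "h i \<le> h r"
    proof (induction rule: dec_induct)
      case (step n)
      then show ?case using dec[of n] by simp
    qed simp
    also have "h r \<le> (\<Sum>j\<le>r. j + 1)" unfolding sum[OF order_refl] by (intro sum_mono le)
    also have "\<dots> \<le> (\<Sum>j\<le>i. j + 1)" using False by (intro sum_mono2) auto
    finally show ?thesis using full by simp
  qed
  fix i :: nat assume "1 \<le> i"
  show "h (Suc i) \<le> mac_upper i (h i)"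
  proof (cases "i < r")
    case False
    then have "h (Suc i) \<le> h i" by (simp add: dec)
    \<comment> \<open>Comparison with a curve of degree 0.\<close>
    also have "\<dots> \<le> mac_upper i (h i)"
      using mac_upper_ge_curve[of i 0 "h i"] bound \<open>1 \<le> i\<close> by (simp add: curve_hilb_def)
    finally show ?thesis .
  next
    case True
    show ?thesis
    proof (cases "d i \<le> i")
      case False
      then have "d i = i + 1" using le[of i] by simp
      then have "h i = (\<Sum>j\<le>i. j + 1)"
        unfolding sum[OF less_imp_le[OF True]]
        using ge_min[of _ i] le by (intro sum.cong refl antisym) (auto simp: min_def split: if_splits)
      then have "mac_upper i (h i) = (i + 3) choose (i + 1)"
        using full mac_upper_choose[of i "i + 2"] \<open>1 \<le> i\<close> by (simp add: numeral_3_eq_3)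
      then show ?thesis using bound[of "Suc i"] by (simp add: numeral_3_eq_3)
    next
      case small: True
      have "curve_hilb i (d i) \<le> h i"
        unfolding sum[OF less_imp_le[OF True]] curve_hilb_eq_sum[OF le] using ge_min
        by (intro sum_mono) simp
      then have "h i + d i \<le> mac_upper i (h i)"
        using mac_upper_ge_curve le bound \<open>1 \<le> i\<close> by blast
      then show ?thesis using inc[OF True] step[OF small] by simp
    qed
  qed
qed

end

section \<open>Dimensions of finitely spanned subspaces\<close>

(* A separate locale: facts added to vector_space itself would be shadowed by their
   instances for real vector spaces. *)
locale fin_vector_space = vector_space
begin

text \<open>The space of all polynomials is infinite-dimensional; the usual rules for
  \<open>dim\<close> are proved for sets that lie in the span of a finite set.\<close>

definition fin_span :: "'b set \<Rightarrow> bool" where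
  "fin_span S \<longleftrightarrow> (\<exists>B. finite B \<and> S \<subseteq> span B)"

lemma fin_span_subset: "fin_span T \<Longrightarrow> S \<subseteq> span T \<Longrightarrow> fin_span S"
  unfolding fin_span_def using span_minimal[OF _ subspace_span] by blast

lemma fin_span_finite: "finite S \<Longrightarrow> fin_span S"
  unfolding fin_span_def using span_superset by blast

lemma fin_span_Un:
  assumes "fin_span S" "fin_span T"
  shows "fin_span (S \<union> T)"
proof -
  obtain B C where "finite B" "S \<subseteq> span B" "finite C" "T \<subseteq> span C"
    using assms unfolding fin_span_def by blast
  moreover have "span B \<subseteq> span (B \<union> C)" "span C \<subseteq> span (B \<union> C)"
    by (simp_all add: span_mono)
  ultimately show ?thesis unfolding fin_span_def
    by (intro exI[of _ "B \<union> C"]) auto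
qed

lemma fin_span_extend:
  assumes "fin_span S" "independent B0" "B0 \<subseteq> S"
  obtains B where "B0 \<subseteq> B" "B \<subseteq> S" "independent B" "finite B" "span B = span S" "card B = dim S"
proof -
  obtain B where B: "B0 \<subseteq> B" "B \<subseteq> S" "independent B" "S \<subseteq> span B"
    using maximal_independent_subset_extend[OF assms(3,2)] by blast
  obtain T where "finite T" "S \<subseteq> span T" using assms(1) by (auto simp: fin_span_def)
  with B have "finite B"
    by (intro independent_span_bound[THEN conjunct1, of T B]) auto
  moreover have "span B = span S" using B span_mono[OF B(2)] span_minimal[OF B(4) subspace_span] by blast
  moreover have "card B = dim S" using B by (intro basis_card_eq_dim)
  ultimately show thesis using B by (intro that)
qed

lemma fin_span_basis:
  assumes "fin_span S"
  obtains B where "B \<subseteq> S" "independent B" "finite B" "span B = span S" "card B = dim S"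
  by (rule fin_span_extend[OF assms independent_empty empty_subsetI]) (rule that)

lemma dim_insert_fin:
  assumes "fin_span S"
  shows "dim (insert b S) = (if b \<in> span S then dim S else Suc (dim S))"
proof (cases "b \<in> span S")
  case True
  then have "span (insert b S) = span S" by (rule span_redundant)
  then show ?thesis using True by (metis dim_span)
next
  case False
  obtain B where B: "B \<subseteq> S" "independent B" "finite B" "span B = span S" "card B = dim S"
    using fin_span_basis[OF assms] .
  then have "b \<notin> span B" "b \<notin> B" using False span_superset by auto
  then have "independent (insert b B)" using B independent_insertI by blast
  moreover have "insert b S \<subseteq> span (insert b B)"
    using B(4) span_superset[of S] span_mono[of B "insert b B"] span_base[of b "insert b B"] by auto
  ultimately have "card (insert b B) = dim (insert b S)"
    using B by (intro basis_card_eq_dim) auto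
  then show ?thesis using False B \<open>b \<notin> B\<close> by simp
qed

lemma dim_mono_fin:
  assumes "fin_span T" "S \<subseteq> span T"
  shows "dim S \<le> dim T"
proof -
  obtain B where B: "B \<subseteq> T" "independent B" "finite B" "span B = span T" "card B = dim T"
    using fin_span_basis[OF assms(1)] .
  then show ?thesis using dim_le_card[of S B] assms by simp
qed

text \<open>A vector of \<open>span T\<close> outside \<open>span S\<close> would raise the
  dimension of \<open>S\<close> above that of \<open>T\<close>.\<close>

lemma span_eq_of_dim_ge:
  assumes "fin_span T" "S \<subseteq> span T" "dim T \<le> dim S"
  shows "span S = span T"
proof -
  have fS: "fin_span S" by (rule fin_span_subset[OF assms(1,2)])
  have "b \<in> span S" if "b \<in> span T" for b
  proof (rule ccontr)
    assume "b \<notin> span S"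
    then have "dim (insert b S) = Suc (dim S)" using dim_insert_fin[OF fS] by simp
    moreover have "dim (insert b S) \<le> dim T"
      using that assms by (intro dim_mono_fin) auto
    ultimately show False using assms(3) by simp
  qed
  then show ?thesis using span_minimal[OF assms(2) subspace_span] by blast
qed

lemma dim_zero_fin:
  assumes "fin_span S" "dim S = 0" "x \<in> S"
  shows "x = 0"
proof -
  have "span {} = span S"
    using assms by (intro span_eq_of_dim_ge) auto
  then have "span S = {0}" by simp
  with span_base[OF assms(3)] show ?thesis by (simp only: singleton_iff)
qed

end

text \<open>Rank--nullity for the map from \<open>V\<close> to the ambient space modulo \<open>U\<close>, without quotients.\<close>
lemma (in fin_vector_space) dim_preimage_plus_image:
  assumes lin: "Vector_Spaces.linear scale scale \<phi>"
    and V: "subspace V" "fin_span V" and U: "subspace U" "fin_span U"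
  shows "dim V + dim U = dim {v\<in>V. \<phi> v \<in> U} + dim (\<phi> ` V \<union> U)"
proof -
  interpret \<phi>: Vector_Spaces.linear scale scale \<phi> by (rule lin)
  define P where "P = {v\<in>V. \<phi> v \<in> U}"
  have fP: "fin_span P"
    by (rule fin_span_subset[OF V(2)]) (auto simp: P_def span_base)
  have span_image: "\<phi> ` span X = span (\<phi> ` X)" for X by (rule \<phi>.span_image[symmetric])
  have fin_image: "fin_span (\<phi> ` X)" if X: "fin_span X" for X
  proof -
    obtain B where B: "finite B" "X \<subseteq> span B" using X unfolding fin_span_def by blast
    then have "\<phi> ` X \<subseteq> span (\<phi> ` B)" unfolding span_image[symmetric] by (intro image_mono)
    then show ?thesis unfolding fin_span_def using B(1) by blast
  qed
  \<comment> \<open>\<open>V\<close> is built up from the preimage \<open>P\<close> by adjoining one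
    vector at a time; each one raises both dimensions or neither.\<close>
  have "dim (P \<union> C) + dim U = dim P + dim (\<phi> ` (P \<union> C) \<union> U)" if "finite C" "C \<subseteq> V" for C
    using that
  proof (induction C rule: finite_induct)
    case empty
    have "\<phi> ` P \<union> U = U" by (auto simp: P_def)
    then show ?case by simp
  next
    case (insert c C)
    let ?W = "P \<union> C"
    have fW: "fin_span ?W" by (rule fin_span_Un[OF fP fin_span_finite[OF insert(1)]])
    have fI: "fin_span (\<phi> ` ?W \<union> U)" by (rule fin_span_Un[OF fin_image[OF fW] U(2)])
    have sub: "span ?W \<subseteq> V" using insert.prems V by (intro span_minimal) (auto simp: P_def)
    \<comment> \<open>If the image of \<open>c\<close> agrees with that of some \<open>w\<close> in
      the span up to \<open>u \<in> U\<close>, then \<open>c - w\<close> lies in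
      \<open>P\<close>.\<close>
    have iff: "\<phi> c \<in> span (\<phi> ` ?W \<union> U) \<longleftrightarrow> c \<in> span ?W"
    proof
      assume "c \<in> span ?W"
      then have "\<phi> c \<in> span (\<phi> ` ?W)" unfolding span_image[symmetric] by (rule imageI)
      then show "\<phi> c \<in> span (\<phi> ` ?W \<union> U)" using span_mono[of "\<phi> ` ?W" "\<phi> ` ?W \<union> U"] by blast
    next
      assume "\<phi> c \<in> span (\<phi> ` ?W \<union> U)"
      then obtain w u where wu: "\<phi> c = \<phi> w + u" "w \<in> span ?W" "u \<in> span U"
        unfolding span_Un span_image[symmetric] by blast
      have "u \<in> U" using wu(3) span_minimal[OF subset_refl U(1)] by blast
      have "c - w \<in> V" using sub wu insert.prems V by (intro subspace_diff) auto
      moreover have "\<phi> (c - w) = u" using wu by (simp add: \<phi>.diff)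
      ultimately have "c - w \<in> P" using \<open>u \<in> U\<close> by (simp add: P_def)
      then have "c - w \<in> span ?W" by (intro span_base) simp
      then show "c \<in> span ?W" using span_add[OF _ wu(2), of "c - w"] by simp
    qed
    have "P \<union> insert c C = insert c ?W" "\<phi> ` (P \<union> insert c C) \<union> U = insert (\<phi> c) (\<phi> ` ?W \<union> U)" by auto
    moreover have "dim ?W + dim U = dim P + dim (\<phi> ` ?W \<union> U)"
      using insert.IH insert.prems by blast
    ultimately show ?case
      using dim_insert_fin[OF fW, of c] dim_insert_fin[OF fI, of "\<phi> c"] iff by simp
  qed
  moreover obtain B where B: "B \<subseteq> V" "finite B" "span B = span V" using fin_span_basis[OF V(2)] .
  ultimately have eq: "dim (P \<union> B) + dim U = dim P + dim (\<phi> ` (P \<union> B) \<union> U)" by blast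
  have spPB: "span (P \<union> B) = V"
  proof
    show "span (P \<union> B) \<subseteq> V"
      using B V(1) by (intro span_minimal) (auto simp: P_def)
    have "V \<subseteq> span B" unfolding B(3) by (rule span_superset)
    also have "\<dots> \<subseteq> span (P \<union> B)" by (rule span_mono) simp
    finally show "V \<subseteq> span (P \<union> B)" .
  qed
  moreover have "span (\<phi> ` (P \<union> B) \<union> U) = span (\<phi> ` V \<union> U)"
  proof -
    have "span V = V" using V(1) by simp
    then have "\<phi> ` span (P \<union> B) = \<phi> ` span V" using spPB by (simp only:)
    then show ?thesis
      unfolding span_Un[of "\<phi> ` (P \<union> B)"] span_Un[of "\<phi> ` V"] span_image[symmetric] by simp
  qed
  ultimately show ?thesis
    using eq dim_span[of "P \<union> B"] dim_span[of "\<phi> ` (P \<union> B) \<union> U"] dim_span[of "\<phi> ` V \<union> U"]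
    unfolding P_def by simp
qed

section \<open>Forms in three variables\<close>

lemma pscale_conv_mult: "pscale c p = Poly_Mapping.single 0 c * p"
  unfolding pscale_def by (rule mult_map_scale_conv_mult)

lemma lookup_pscale [simp]: "Poly_Mapping.lookup (pscale c p) m = c * Poly_Mapping.lookup p m"
  unfolding pscale_def by (simp add: Poly_Mapping.map.rep_eq "when_def")

global_interpretation mp: fin_vector_space "pscale :: 'k::field \<Rightarrow> 'k mpoly \<Rightarrow> 'k mpoly"
  by unfold_locales (auto intro!: poly_mapping_eqI simp: lookup_add algebra_simps)

lemma kdim_eq_dim: "kdim = mp.dim"
  unfolding kdim_def ..

lemma mult_pscale_right: "p * pscale c q = pscale c (p * q)"
  unfolding pscale_conv_mult by (simp add: mult.left_commute)

lemma mult_pscale_left: "pscale c p * q = pscale c (p * q)"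
  unfolding pscale_conv_mult by (simp add: mult.assoc)

lemma linear_mult_left: "Vector_Spaces.linear pscale pscale (\<lambda>f. g * f)"
  by unfold_locales (simp_all add: distrib_left mult_pscale_right)

lemma sum_single_lookup: "(\<Sum>m\<in>Poly_Mapping.keys p. Poly_Mapping.single m (Poly_Mapping.lookup p m)) = p"
proof (rule poly_mapping_eqI)
  fix k
  have "(\<Sum>m\<in>Poly_Mapping.keys p. Poly_Mapping.lookup (Poly_Mapping.single m (Poly_Mapping.lookup p m)) k)
      = (\<Sum>m\<in>Poly_Mapping.keys p. if m = k then Poly_Mapping.lookup p k else 0)"
    by (intro sum.cong) (auto simp: lookup_single "when_def")
  also have "\<dots> = Poly_Mapping.lookup p k"
    by (auto simp: in_keys_iff)
  finally show "Poly_Mapping.lookup (\<Sum>m\<in>Poly_Mapping.keys p. Poly_Mapping.single m (Poly_Mapping.lookup p m)) k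
      = Poly_Mapping.lookup p k"
    by (simp add: lookup_sum)
qed

lemma mdeg_superset:
  assumes "finite A" "Poly_Mapping.keys m \<subseteq> A"
  shows "mdeg m = (\<Sum>i\<in>A. Poly_Mapping.lookup m i)"
  unfolding mdeg_def using assms by (intro sum.mono_neutral_left) (auto simp: in_keys_iff)

lemma mdeg_add: "mdeg (m + n) = mdeg m + mdeg n"
proof -
  let ?A = "Poly_Mapping.keys m \<union> Poly_Mapping.keys n"
  have "Poly_Mapping.keys (m + n) \<subseteq> ?A" by (rule keys_add)
  then show ?thesis
    using mdeg_superset[of ?A] by (simp add: lookup_add sum.distrib)
qed

lemma mdeg_zero [simp]: "mdeg 0 = 0"
  by (simp add: mdeg_def)

lemma mdeg_eq_zero: "mdeg m = 0 \<longleftrightarrow> m = 0"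
  by (auto simp: mdeg_def in_keys_iff intro!: poly_mapping_eqI)

lemma mdeg_single [simp]: "mdeg (Poly_Mapping.single i e) = e"
  by (simp add: mdeg_def)

lemma R3_zero [simp]: "0 \<in> R3" and R3_one [simp]: "1 \<in> R3"
  by (simp_all add: R3_def)

lemma R3_single: "Poly_Mapping.single m c \<in> R3 \<longleftrightarrow> c = 0 \<or> Poly_Mapping.keys m \<subseteq> {0,1,2}"
  by (simp add: R3_def)

lemma R3_add: "p \<in> R3 \<Longrightarrow> q \<in> R3 \<Longrightarrow> p + q \<in> R3"
  unfolding R3_def using keys_add[of p q] by blast

lemma R3_mult:
  assumes "p \<in> R3" "q \<in> R3"
  shows "p * q \<in> R3"
  unfolding R3_def
proof (intro CollectI ballI)
  fix m assume "m \<in> Poly_Mapping.keys (p * q)"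
  then obtain a b where "m = a + b" "a \<in> Poly_Mapping.keys p" "b \<in> Poly_Mapping.keys q"
    using keys_mult[of p q] by blast
  then show "Poly_Mapping.keys m \<subseteq> {0,1,2}"
    using assms keys_add[of a b] unfolding R3_def by blast
qed

lemma R3_pscale: "p \<in> R3 \<Longrightarrow> pscale c p \<in> R3"
  unfolding pscale_conv_mult by (rule R3_mult) (simp_all add: R3_single)

lemma forms_subset_R3: "forms d \<subseteq> R3"
  by (auto simp: forms_def)

lemma formsD: "f \<in> forms d \<Longrightarrow> m \<in> Poly_Mapping.keys f \<Longrightarrow> mdeg m = d"
  by (auto simp: forms_def)

lemma subspace_forms: "mp.subspace (forms d :: 'k::field mpoly set)"
  unfolding mp.subspace_def
proof (intro conjI ballI allI)
  fix c and p q :: "'k mpoly"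
  assume pq: "p \<in> forms d"
  show "pscale c p \<in> forms d"
    using pq by (auto simp: forms_def R3_pscale in_keys_iff)
  assume "q \<in> forms d"
  then show "p + q \<in> forms d"
    using pq keys_add[of p q] unfolding forms_def by (auto simp: R3_add)
qed (simp add: forms_def)

lemma forms_mult:
  assumes "p \<in> forms a" "q \<in> forms b"
  shows "p * q \<in> forms (a + b)"
proof -
  have "mdeg m = a + b" if m: "m \<in> Poly_Mapping.keys (p * q)" for m
  proof -
    obtain x y where "m = x + y" "x \<in> Poly_Mapping.keys p" "y \<in> Poly_Mapping.keys q"
      using m keys_mult[of p q] by blast
    then show ?thesis using assms by (simp add: mdeg_add formsD)
  qed
  then show ?thesis using assms R3_mult by (auto simp: forms_def)
qed

lemma linear_mult_forms: "l \<in> forms 1 \<Longrightarrow> f \<in> forms d \<Longrightarrow> l * f \<in> forms (Suc d)"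
  using forms_mult[of l 1 f d] by simp

lemma forms_power: "l \<in> forms 1 \<Longrightarrow> l ^ n \<in> forms n"
proof (induction n)
  case 0
  show ?case by (simp add: forms_def)
qed (simp add: linear_mult_forms)

lemma Xvar_forms: "i < 3 \<Longrightarrow> Xvar i \<in> forms 1"
  by (auto simp: Xvar_def forms_def R3_single)

lemma single_eq_Xvar_mult:
  fixes m :: "nat \<Rightarrow>\<^sub>0 nat"
  assumes "m \<noteq> 0" "Poly_Mapping.keys m \<subseteq> {0,1,2}"
  obtains i n where "i < 3" "m = Poly_Mapping.single i 1 + n" "Poly_Mapping.keys n \<subseteq> {0,1,2}"
    "\<And>c :: 'k::field. Poly_Mapping.single m c = Xvar i * Poly_Mapping.single n c"
proof -
  obtain i where i: "i \<in> Poly_Mapping.keys m"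
    using assms(1) by (metis ex_in_conv keys_eq_empty)
  define n where "n = m - Poly_Mapping.single i 1"
  have m: "m = Poly_Mapping.single i 1 + n"
    using i by (intro poly_mapping_eqI) (auto simp: n_def lookup_add lookup_minus lookup_single "when_def" in_keys_iff)
  have "Poly_Mapping.keys n \<subseteq> Poly_Mapping.keys m"
    by (auto simp: n_def in_keys_iff lookup_minus)
  then have "Poly_Mapping.keys n \<subseteq> {0,1,2}" using assms(2) by (rule order_trans)
  moreover have "i < 3" using i assms(2) by auto
  moreover have "Poly_Mapping.single m c = Xvar i * Poly_Mapping.single n c" for c :: 'k
    unfolding Xvar_def mult_single m by simp
  ultimately show thesis using m by (intro that)
qed

text \<open>Every monomial of positive degree is a variable times a monomial. Claims about all forms
  of the next degree are reduced to products with a variable through this rule.\<close>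

lemma forms_Suc_subset:
  fixes S :: "'k::field mpoly set"
  assumes S: "mp.subspace S" and mem: "\<And>i f. i < 3 \<Longrightarrow> f \<in> forms d \<Longrightarrow> Xvar i * f \<in> S"
  shows "forms (Suc d) \<subseteq> S"
proof
  fix p :: "'k mpoly"
  assume p: "p \<in> forms (Suc d)"
  have "Poly_Mapping.single m (Poly_Mapping.lookup p m) \<in> S" if m: "m \<in> Poly_Mapping.keys p" for m
  proof -
    have deg: "mdeg m = Suc d" using p m by (rule formsD)
    have "Poly_Mapping.keys m \<subseteq> {0,1,2}" using p m by (auto simp: forms_def R3_def)
    moreover have "m \<noteq> 0" using deg by auto
    ultimately obtain i n where in': "i < 3" "m = Poly_Mapping.single i 1 + n" "Poly_Mapping.keys n \<subseteq> {0,1,2}"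
      "\<And>c :: 'k. Poly_Mapping.single m c = Xvar i * Poly_Mapping.single n c"
      using single_eq_Xvar_mult[of m, where ?'k = 'k] by blast
    have "mdeg n = d" using deg in'(2) by (simp add: mdeg_add)
    then have "Poly_Mapping.single n (Poly_Mapping.lookup p m) \<in> forms d"
      using in'(3) by (simp add: forms_def R3_single)
    then show ?thesis unfolding in'(4) by (rule mem[OF in'(1)])
  qed
  then have "(\<Sum>m\<in>Poly_Mapping.keys p. Poly_Mapping.single m (Poly_Mapping.lookup p m)) \<in> S"
    by (rule mp.subspace_sum[OF S])
  then show "p \<in> S" by (simp only: sum_single_lookup)
qed

lemma forms_zero: "(forms 0 :: 'k::field mpoly set) = mp.span {1}"
proof
  show "mp.span {1} \<subseteq> (forms 0 :: 'k mpoly set)"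
    by (rule mp.span_minimal[OF _ subspace_forms]) (simp add: forms_def)
  show "(forms 0 :: 'k mpoly set) \<subseteq> mp.span {1}"
  proof
    fix p :: "'k mpoly" assume p: "p \<in> forms 0"
    have "p = pscale (Poly_Mapping.lookup p 0) 1"
    proof (rule poly_mapping_eqI)
      fix m
      show "Poly_Mapping.lookup p m = Poly_Mapping.lookup (pscale (Poly_Mapping.lookup p 0) 1) m"
        using formsD[OF p, of m] by (auto simp: lookup_one "when_def" mdeg_eq_zero in_keys_iff)
    qed
    then obtain c where "p = pscale c 1" by blast
    then show "p \<in> mp.span {1}" by (simp add: mp.span_scale mp.span_base)
  qed
qed

lemma fin_span_forms: "mp.fin_span (forms d :: 'k::field mpoly set)"
proof (induction d)
  case 0
  show ?case unfolding forms_zero mp.fin_span_def by blast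
next
  case (Suc d)
  then obtain B :: "'k mpoly set" where B: "finite B" "forms d \<subseteq> mp.span B" unfolding mp.fin_span_def by blast
  let ?C = "\<Union>i\<in>{..<3}. (\<lambda>f. Xvar i * f) ` B"
  have "forms (Suc d) \<subseteq> mp.span ?C"
  proof (rule forms_Suc_subset[OF mp.subspace_span])
    fix i :: nat and f :: "'k mpoly" assume i: "i < 3" and f: "f \<in> forms d"
    interpret X: Vector_Spaces.linear pscale pscale "\<lambda>f. Xvar i * f :: 'k mpoly"
      by (rule linear_mult_left)
    have "Xvar i * f \<in> (\<lambda>f. Xvar i * f) ` mp.span B" using f B by blast
    also have "\<dots> = mp.span ((\<lambda>f. Xvar i * f) ` B)" by (rule X.span_image[symmetric])
    also have "\<dots> \<subseteq> mp.span ?C" using i by (intro mp.span_mono) blast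
    finally show "Xvar i * f \<in> mp.span ?C" .
  qed
  then show ?case using B(1) unfolding mp.fin_span_def by (intro exI[of _ ?C]) simp
qed

lemma fin_span_subset_forms: "S \<subseteq> forms d \<Longrightarrow> mp.fin_span S"
  by (rule mp.fin_span_subset[OF fin_span_forms]) (rule order_trans[OF _ mp.span_superset])

lemma dim_forms_mono: "S \<subseteq> T \<Longrightarrow> T \<subseteq> forms d \<Longrightarrow> mp.dim S \<le> mp.dim T"
  by (rule mp.dim_mono_fin[OF fin_span_subset_forms]) (auto intro: mp.span_base)

lemma subspace_forms_eqI:
  assumes "mp.subspace S" "mp.subspace T" "S \<subseteq> T" "T \<subseteq> forms d" "mp.dim T \<le> mp.dim S"
  shows "S = T"
proof -
  have "mp.span S = mp.span T"
    using assms by (intro mp.span_eq_of_dim_ge fin_span_subset_forms) (auto intro: mp.span_base)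
  moreover have "mp.span S = S" "mp.span T = T" using assms by simp_all
  ultimately show ?thesis by (simp only:)
qed

lemma dim_forms_zero: "mp.dim (forms 0 :: 'k::field mpoly set) = 1"
proof -
  have "mp.independent {1 :: 'k mpoly}" by (simp add: mp.dependent_single)
  then show ?thesis unfolding forms_zero using mp.dim_span_eq_card_independent[of "{1 :: 'k mpoly}"] by simp
qed

lemma linform_eq: "linform a = (\<Sum>i<3. pscale (a i) (Xvar i))"
  unfolding linform_def pscale_conv_mult Xvar_def mult_single by simp

lemma linform_forms: "linform a \<in> forms 1"
  unfolding linform_eq
  by (intro mp.subspace_sum[OF subspace_forms] mp.subspace_scale[OF subspace_forms] Xvar_forms) simp

text \<open>Identifies the linear forms in \<open>WLP\<close> with the parametrised ones in
  \<open>r1\<close>.\<close>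

lemma forms_one: "(forms 1 :: 'k::field mpoly set) = range linform"
proof
  have sub: "mp.subspace (range linform :: 'k mpoly set)"
    unfolding mp.subspace_def
  proof (intro conjI ballI allI)
    show "0 \<in> range (linform :: _ \<Rightarrow> 'k mpoly)"
      by (intro image_eqI[of _ _ "\<lambda>_. 0"]) (simp_all add: linform_def)
    fix p q :: "'k mpoly" and c
    assume "p \<in> range linform"
    then obtain a where p: "p = linform a" by blast
    show "pscale c p \<in> range linform" unfolding p
      by (intro image_eqI[of _ _ "\<lambda>i. c * a i"]) (simp_all add: linform_eq mp.scale_sum_right)
    assume "q \<in> range linform"
    then obtain b where q: "q = linform b" by blast
    show "p + q \<in> range linform" unfolding p q
      by (intro image_eqI[of _ _ "\<lambda>i. a i + b i"]) (simp_all add: linform_eq mp.scale_left_distrib sum.distrib)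
  qed
  have "Xvar i * f \<in> range linform" if i: "i < 3" and f: "f \<in> forms 0" for i and f :: "'k mpoly"
  proof -
    obtain c where "f = pscale c 1"
      using f unfolding forms_zero mp.span_singleton by blast
    then have "Xvar i * f = pscale c (Xvar i)" by (simp add: mult_pscale_right)
    moreover have "(\<Sum>j<3. pscale (if j = i then 1 else 0) (Xvar j)) = (Xvar i :: 'k mpoly)"
      using i by (simp add: if_distrib[of "\<lambda>c. pscale c _"] cong: if_cong)
    then have "Xvar i \<in> range (linform :: _ \<Rightarrow> 'k mpoly)"
      unfolding linform_eq by (intro image_eqI[of _ _ "\<lambda>j. if j = i then 1 else 0"]) auto
    ultimately show ?thesis using sub by (simp add: mp.subspace_scale)
  qed
  then show "forms 1 \<subseteq> (range linform :: 'k mpoly set)"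
    using forms_Suc_subset[OF sub, of 0] by simp
  show "range linform \<subseteq> (forms 1 :: 'k mpoly set)" using linform_forms by blast
qed

lemma lookup_hcomp:
  "Poly_Mapping.lookup (hcomp d p) m = (if mdeg m = d then Poly_Mapping.lookup p m else 0)"
proof -
  let ?A = "{m \<in> Poly_Mapping.keys p. mdeg m = d}"
  have "Poly_Mapping.lookup (hcomp d p) m = (\<Sum>k\<in>?A. if k = m then Poly_Mapping.lookup p m else 0)"
    unfolding hcomp_def lookup_sum by (intro sum.cong) (auto simp: lookup_single "when_def")
  also have "\<dots> = (if mdeg m = d then Poly_Mapping.lookup p m else 0)"
    by (auto simp: in_keys_iff)
  finally show ?thesis .
qed

lemma hcomp_diff: "hcomp d (p - q) = hcomp d p - hcomp d q"
  by (rule poly_mapping_eqI) (simp add: lookup_hcomp lookup_minus)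

lemma hcomp_add: "hcomp d (p + q) = hcomp d p + hcomp d q"
  by (rule poly_mapping_eqI) (simp add: lookup_hcomp lookup_add)

lemma hcomp_form: "f \<in> forms e \<Longrightarrow> hcomp d f = (if d = e then f else 0)"
  by (intro poly_mapping_eqI) (auto simp: lookup_hcomp in_keys_iff dest: formsD)

lemma hcomp_forms:
  assumes "p \<in> R3"
  shows "hcomp d p \<in> forms d"
proof -
  have "m \<in> Poly_Mapping.keys p \<and> mdeg m = d" if "m \<in> Poly_Mapping.keys (hcomp d p)" for m
    using that by (simp add: in_keys_iff lookup_hcomp split: if_splits)
  with assms show ?thesis unfolding forms_def R3_def by blast
qed

text \<open>Components of \<open>q\<close> outside degree \<open>d\<close> only contribute to
  degrees other than \<open>Suc d\<close>. This makes the arbitrary cofactor in \<open>r1_at\<close>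
  homogeneous.\<close>

lemma hcomp_linear_mult:
  assumes l: "l \<in> forms 1" and "q \<in> R3"
  shows "hcomp (Suc d) (l * q) = l * hcomp d q"
proof -
  let ?r = "q - hcomp d q"
  have "mdeg m \<noteq> Suc d" if m: "m \<in> Poly_Mapping.keys (l * ?r)" for m
  proof -
    obtain x y where xy: "m = x + y" "x \<in> Poly_Mapping.keys l" "y \<in> Poly_Mapping.keys ?r"
      using m keys_mult[of l ?r] by blast
    then have "mdeg y \<noteq> d" by (auto simp: in_keys_iff lookup_minus lookup_hcomp)
    then show ?thesis using xy formsD[OF l] by (simp add: mdeg_add)
  qed
  then have "hcomp (Suc d) (l * ?r) = 0"
    by (intro poly_mapping_eqI) (auto simp: lookup_hcomp in_keys_iff)
  moreover have "hcomp (Suc d) (l * hcomp d q) = l * hcomp d q"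
    using hcomp_form[OF linear_mult_forms[OF l hcomp_forms[OF \<open>q \<in> R3\<close>]]] by simp
  moreover have "l * q = l * hcomp d q + l * ?r" by (simp add: algebra_simps)
  ultimately show ?thesis by (simp only: hcomp_add) simp
qed

section \<open>Polynomial functions and generic linear forms\<close>

definition meval :: "(nat \<Rightarrow> 'k::field) \<Rightarrow> (nat \<Rightarrow>\<^sub>0 nat) \<Rightarrow> 'k" where
  "meval a m = (\<Prod>i\<in>Poly_Mapping.keys m. a i ^ Poly_Mapping.lookup m i)"

lemma meval_superset:
  assumes "finite A" "Poly_Mapping.keys m \<subseteq> A"
  shows "meval a m = (\<Prod>i\<in>A. a i ^ Poly_Mapping.lookup m i)"
  unfolding meval_def using assms by (intro prod.mono_neutral_left) (auto simp: in_keys_iff)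

lemma meval_add: "meval a (m + n) = meval a m * meval a n"
proof -
  let ?A = "Poly_Mapping.keys m \<union> Poly_Mapping.keys n"
  have "Poly_Mapping.keys (m + n) \<subseteq> ?A" by (rule keys_add)
  then show ?thesis
    using meval_superset[of ?A m a] meval_superset[of ?A n a] meval_superset[of ?A "m + n" a]
    by (simp add: lookup_add power_add prod.distrib)
qed

lemma peval_superset:
  assumes "finite A" "Poly_Mapping.keys F \<subseteq> A"
  shows "peval F a = (\<Sum>m\<in>A. Poly_Mapping.lookup F m * meval a m)"
  unfolding peval_def meval_def[symmetric] using assms
  by (intro sum.mono_neutral_left) (auto simp: in_keys_iff)

lemma peval_zero [simp]: "peval 0 a = 0"
  by (simp add: peval_def)

lemma peval_single: "peval (Poly_Mapping.single m c) a = c * meval a m"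
  by (subst peval_superset[of "{m}"]) auto

lemma peval_add: "peval (F + G) a = peval F a + peval G a"
proof -
  let ?A = "Poly_Mapping.keys F \<union> Poly_Mapping.keys G"
  have "Poly_Mapping.keys (F + G) \<subseteq> ?A" by (rule keys_add)
  then show ?thesis
    using peval_superset[of ?A F a] peval_superset[of ?A G a] peval_superset[of ?A "F + G" a]
    by (simp add: lookup_add distrib_right sum.distrib)
qed

lemma peval_sum: "peval (\<Sum>x\<in>A. F x) a = (\<Sum>x\<in>A. peval (F x) a)"
  by (induction A rule: infinite_finite_induct) (simp_all add: peval_add)

lemma peval_mult: "peval (F * G) a = peval F a * peval G a"
proof -
  let ?s = "\<lambda>F m. Poly_Mapping.single m (Poly_Mapping.lookup F m)"
  have "F * G = (\<Sum>m\<in>Poly_Mapping.keys F. ?s F m) * (\<Sum>n\<in>Poly_Mapping.keys G. ?s G n)"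
    by (simp only: sum_single_lookup)
  also have "\<dots> = (\<Sum>m\<in>Poly_Mapping.keys F. \<Sum>n\<in>Poly_Mapping.keys G.
      Poly_Mapping.single (m + n) (Poly_Mapping.lookup F m * Poly_Mapping.lookup G n))"
    by (simp only: sum_product mult_single)
  finally have "peval (F * G) a = (\<Sum>m\<in>Poly_Mapping.keys F. \<Sum>n\<in>Poly_Mapping.keys G.
      (Poly_Mapping.lookup F m * meval a m) * (Poly_Mapping.lookup G n * meval a n))"
    by (simp only: peval_sum peval_single meval_add mult_ac)
  then show ?thesis
    by (simp only: sum_product peval_def meval_def)
qed

text \<open>Genericity depends on values only, so conditions on the coefficients of a linear form
  are handled as functions; the closure rules below replace explicit polynomials.\<close>

definition poly_funs :: "((nat \<Rightarrow> 'k::field) \<Rightarrow> 'k) set" where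
  "poly_funs = peval ` R3"

lemma poly_funs_const: "(\<lambda>a. c) \<in> poly_funs"
  unfolding poly_funs_def
  by (rule image_eqI[of _ _ "Poly_Mapping.single 0 c"]) (auto simp: peval_single meval_def R3_single)

lemma poly_funs_coord: "i < 3 \<Longrightarrow> (\<lambda>a. a i) \<in> poly_funs"
  unfolding poly_funs_def
  by (rule image_eqI[of _ _ "Xvar i"]) (auto simp: Xvar_def peval_single meval_def R3_single)

lemma poly_funs_add: "f \<in> poly_funs \<Longrightarrow> g \<in> poly_funs \<Longrightarrow> (\<lambda>a. f a + g a) \<in> poly_funs"
  unfolding poly_funs_def by (auto intro!: image_eqI[of _ _ "_ + _"] R3_add simp: peval_add)

lemma poly_funs_mult: "f \<in> poly_funs \<Longrightarrow> g \<in> poly_funs \<Longrightarrow> (\<lambda>a. f a * g a) \<in> poly_funs"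
  unfolding poly_funs_def by (auto intro!: image_eqI[of _ _ "_ * _"] R3_mult simp: peval_mult)

lemma poly_funs_diff:
  assumes "f \<in> poly_funs" "g \<in> poly_funs"
  shows "(\<lambda>a. f a - g a) \<in> poly_funs"
  using poly_funs_add[OF assms(1) poly_funs_mult[OF poly_funs_const[of "-1"] assms(2)]] by simp

text \<open>Kronecker substitution: the points \<open>(t, t^D, t^(D^2))\<close> separate the monomials of degree
  less than \<open>D\<close> in each variable.\<close>
lemma kronecker_substitution:
  fixes F :: "'k::field mpoly"
  assumes "F \<in> R3" "F \<noteq> 0"
  shows "\<exists>D0. \<forall>D\<ge>D0. \<exists>q. q \<noteq> 0 \<and> (\<forall>t. poly q t = peval F (\<lambda>i. t ^ (D ^ i)))"
proof -
  let ?l = Poly_Mapping.lookup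
  \<comment> \<open>Larger than every exponent in \<open>F\<close>.\<close>
  define D0 where "D0 = Suc (\<Sum>m\<in>Poly_Mapping.keys F. mdeg m)"
  show ?thesis
  proof (intro exI[of _ D0] allI impI)
    fix D assume D: "D0 \<le> D"
    \<comment> \<open>The number whose base-\<open>D\<close> digits are the exponents of
      \<open>m\<close>.\<close>
    define e where "e m = ?l m 0 + D * (?l m 1 + D * ?l m 2)" for m :: "nat \<Rightarrow>\<^sub>0 nat"
    define q where "q = (\<Sum>m\<in>Poly_Mapping.keys F. monom (?l F m) (e m))"
    have keys: "Poly_Mapping.keys m \<subseteq> {0,1,2}" if "m \<in> Poly_Mapping.keys F" for m
      using assms(1) that by (auto simp: R3_def)
    have lt: "?l m i < D" if m: "m \<in> Poly_Mapping.keys F" for m i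
    proof -
      have "?l m i \<le> mdeg m"
        using member_le_sum[of i "Poly_Mapping.keys m" "?l m"]
        by (cases "i \<in> Poly_Mapping.keys m") (auto simp: mdeg_def in_keys_iff)
      also have "mdeg m \<le> (\<Sum>m\<in>Poly_Mapping.keys F. mdeg m)"
        using m by (intro member_le_sum) auto
      finally show ?thesis using D by (simp add: D0_def)
    qed
    have inj: "m = n" if mn: "m \<in> Poly_Mapping.keys F" "n \<in> Poly_Mapping.keys F" "e m = e n" for m n
    proof -
      have *: "?l p 0 = e p mod D" "?l p 1 = e p div D mod D" "?l p 2 = e p div D div D"
        if "p \<in> Poly_Mapping.keys F" for p
      proof -
        have "0 < D" using D by (simp add: D0_def)
        then have "e p div D = ?l p 1 + D * ?l p 2" "e p mod D = ?l p 0"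
          using lt[OF that, of 0] by (simp_all add: e_def)
        moreover have "(?l p 1 + D * ?l p 2) div D = ?l p 2" "(?l p 1 + D * ?l p 2) mod D = ?l p 1"
          using lt[OF that, of 1] \<open>0 < D\<close> by simp_all
        ultimately show "?l p 0 = e p mod D" "?l p 1 = e p div D mod D" "?l p 2 = e p div D div D"
          by simp_all
      qed
      have "?l m i = ?l n i" for i
      proof (cases "i \<in> {0,1,2}")
        case True
        then show ?thesis using *[OF mn(1)] *[OF mn(2)] mn(3) by auto
      next
        case False
        then have "i \<notin> Poly_Mapping.keys m" "i \<notin> Poly_Mapping.keys n"
          using keys mn(1,2) by blast+
        then show ?thesis by (simp add: in_keys_iff)
      qed
      then show ?thesis by (rule poly_mapping_eqI)
    qed
    obtain m0 where m0: "m0 \<in> Poly_Mapping.keys F"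
      using assms(2) by (metis ex_in_conv keys_eq_empty)
    have "coeff q (e m0) = (\<Sum>m\<in>Poly_Mapping.keys F. if m = m0 then ?l F m0 else 0)"
      unfolding q_def coeff_sum coeff_monom using inj m0 by (intro sum.cong) auto
    also have "\<dots> \<noteq> 0" using m0 by (simp add: in_keys_iff)
    finally have "q \<noteq> 0" by auto
    moreover have "poly q t = peval F (\<lambda>i. t ^ (D ^ i))" for t
    proof -
      have "meval (\<lambda>i. t ^ (D ^ i)) m = t ^ e m" if "m \<in> Poly_Mapping.keys F" for m
        using meval_superset[OF _ keys[OF that], of "\<lambda>i. t ^ (D ^ i)"]
        by (simp add: e_def power_add power_mult power2_eq_square algebra_simps flip: power_mult)
      then show ?thesis
        unfolding q_def poly_sum poly_monom peval_def meval_def[symmetric] by simp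
    qed
    ultimately show "\<exists>q. q \<noteq> 0 \<and> (\<forall>t. poly q t = peval F (\<lambda>i. t ^ (D ^ i)))" by blast
  qed
qed

text \<open>Two nonempty open sets of linear forms meet. One \<open>D\<close> serves both
  polynomials, and the product of the two univariate polynomials has only finitely many roots in an
  infinite field.\<close>

lemma peval_common_nonzero:
  fixes F G :: "'k::field_char_0 mpoly"
  assumes "F \<in> R3" "F \<noteq> 0" "G \<in> R3" "G \<noteq> 0"
  obtains a where "peval F a \<noteq> 0" "peval G a \<noteq> 0"
proof -
  obtain D1 where D1: "\<And>D. D \<ge> D1 \<Longrightarrow> \<exists>q. q \<noteq> 0 \<and> (\<forall>t. poly q t = peval F (\<lambda>i. t ^ (D ^ i)))"
    using kronecker_substitution[OF assms(1,2)] by blast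
  obtain D2 where D2: "\<And>D. D \<ge> D2 \<Longrightarrow> \<exists>q. q \<noteq> 0 \<and> (\<forall>t. poly q t = peval G (\<lambda>i. t ^ (D ^ i)))"
    using kronecker_substitution[OF assms(3,4)] by blast
  obtain p q where pq: "p \<noteq> 0" "q \<noteq> 0"
    "\<And>t. poly p t = peval F (\<lambda>i. t ^ (max D1 D2 ^ i))"
    "\<And>t. poly q t = peval G (\<lambda>i. t ^ (max D1 D2 ^ i))"
    using D1[of "max D1 D2"] D2[of "max D1 D2"] by auto
  have "p * q \<noteq> 0" using pq by simp
  then have "finite {t. poly (p * q) t = 0}" by (rule poly_roots_finite)
  then obtain t where "poly (p * q) t \<noteq> 0"
    using ex_new_if_finite[OF infinite_UNIV_char_0] by blast
  then show thesis using pq by (intro that[of "\<lambda>i. t ^ (max D1 D2 ^ i)"]) auto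
qed

text \<open>The polynomial witnessing openness is built by fraction-free Gaussian elimination.\<close>
lemma generic_independence:
  fixes v :: "'b \<Rightarrow> (nat \<Rightarrow> 'k::field) \<Rightarrow> 'c \<Rightarrow> 'k"
  assumes "finite B"
    and "\<And>i j. i \<in> B \<Longrightarrow> (\<lambda>a. v i a j) \<in> poly_funs"
    and "\<And>c i. (\<And>j. (\<Sum>i\<in>B. c i * v i a0 j) = 0) \<Longrightarrow> i \<in> B \<Longrightarrow> c i = 0"
  shows "\<exists>f\<in>poly_funs. f a0 \<noteq> 0 \<and>
    (\<forall>a. f a \<noteq> 0 \<longrightarrow> (\<forall>c. (\<forall>j. (\<Sum>i\<in>B. c i * v i a j) = 0) \<longrightarrow> (\<forall>i\<in>B. c i = 0)))"
  using assms
proof (induction B arbitrary: v rule: finite_induct)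
  case empty
  then show ?case using poly_funs_const[of 1] by (intro bexI[of _ "\<lambda>a. 1"]) auto
next
  case (insert b B)
  \<comment> \<open>A pivot for \<open>b\<close> that is nonzero at \<open>a0\<close>.\<close>
  obtain j0 where j0: "v b a0 j0 \<noteq> 0"
  proof (rule ccontr)
    assume "\<not> thesis"
    then have "v b a0 j = 0" for j using that by blast
    then have "(\<Sum>i\<in>insert b B. (if i = b then 1 else 0) * v i a0 j) = 0" for j
      by (intro sum.neutral) auto
    from insert.prems(2)[OF this, of b] show False by simp
  qed
  \<comment> \<open>Clears coordinate \<open>j0\<close> by cross-multiplication, so that the entries
    remain polynomial in \<open>a\<close>.\<close>
  define w where "w i a j = v b a j0 * v i a j - v i a j0 * v b a j" for i a j
  have "\<exists>f\<in>poly_funs. f a0 \<noteq> 0 \<and>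
    (\<forall>a. f a \<noteq> 0 \<longrightarrow> (\<forall>c. (\<forall>j. (\<Sum>i\<in>B. c i * w i a j) = 0) \<longrightarrow> (\<forall>i\<in>B. c i = 0)))"
  proof (rule insert.IH)
    show "(\<lambda>a. w i a j) \<in> poly_funs" if "i \<in> B" for i j
      unfolding w_def using that insert.prems(1) by (intro poly_funs_diff poly_funs_mult) auto
  next
    fix c i assume c: "\<And>j. (\<Sum>i\<in>B. c i * w i a0 j) = 0" and i: "i \<in> B"
    \<comment> \<open>A relation among the reduced vectors yields this one among the original
      vectors.\<close>
    define c' where "c' i = (if i = b then - (\<Sum>i\<in>B. c i * v i a0 j0) else c i * v b a0 j0)" for i
    have "(\<Sum>i\<in>insert b B. c' i * v i a0 j) = 0" for j
    proof -
      have "(\<Sum>i\<in>B. c' i * v i a0 j) = (\<Sum>i\<in>B. c i * v b a0 j0 * v i a0 j)"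
        using insert.hyps by (intro sum.cong) (auto simp: c'_def)
      then have "(\<Sum>i\<in>insert b B. c' i * v i a0 j) = (\<Sum>i\<in>B. c i * w i a0 j)"
        using insert.hyps
        by (simp add: c'_def w_def right_diff_distrib sum_subtractf sum_distrib_left sum_distrib_right mult_ac)
      then show ?thesis using c by simp
    qed
    from insert.prems(2)[OF this, of i] i insert.hyps j0 show "c i = 0"
      by (auto simp: c'_def split: if_splits)
  qed
  then obtain f where f: "f \<in> poly_funs" "f a0 \<noteq> 0"
    "\<And>a c i. f a \<noteq> 0 \<Longrightarrow> (\<And>j. (\<Sum>i\<in>B. c i * w i a j) = 0) \<Longrightarrow> i \<in> B \<Longrightarrow> c i = 0"
    by blast
  \<comment> \<open>The factor \<open>v b a j0\<close> keeps the pivot nonzero at \<open>a\<close>,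
    which the back-substitution for \<open>c b\<close> needs.\<close>
  show ?case
  proof (intro bexI[of _ "\<lambda>a. v b a j0 * f a"] conjI allI impI)
    show "(\<lambda>a. v b a j0 * f a) \<in> poly_funs"
      using insert.prems(1) f(1) by (intro poly_funs_mult) auto
    show "v b a0 j0 * f a0 \<noteq> 0" using j0 f(2) by simp
    fix a c assume nz: "v b a j0 * f a \<noteq> 0" and c: "\<forall>j. (\<Sum>i\<in>insert b B. c i * v i a j) = 0"
    have sum: "(\<Sum>i\<in>B. c i * v i a j) = - (c b * v b a j)" for j
      using c insert.hyps by (simp add: eq_neg_iff_add_eq_0 add.commute)
    have "(\<Sum>i\<in>B. c i * w i a j) = 0" for j
    proof -
      have "(\<Sum>i\<in>B. c i * w i a j) =
          v b a j0 * (\<Sum>i\<in>B. c i * v i a j) - (\<Sum>i\<in>B. c i * v i a j0) * v b a j"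
        by (simp add: w_def right_diff_distrib sum_subtractf sum_distrib_left sum_distrib_right mult_ac)
      then show ?thesis unfolding sum by simp
    qed
    then have B: "c i = 0" if "i \<in> B" for i using f(3)[of a c i] nz that by simp
    then have "c b * v b a j0 = 0" using sum[of j0] by simp
    then show "\<forall>i\<in>insert b B. c i = 0" using nz B by simp
  qed
qed

text \<open>A basis of the target is chosen among the multiples of \<open>linform a0\<close> and the
  elements of \<open>U\<close>. Replacing \<open>a0\<close> by \<open>a\<close> in the chosen
  multiples changes the coordinates polynomially, so independence persists off a hypersurface, and a
  dimension count gives surjectivity.\<close>

lemma generic_surjectivity:
  fixes U :: "'k::field mpoly set"
  assumes U: "U \<subseteq> forms (Suc d)"
    and surj: "forms (Suc d) \<subseteq> mp.span ((\<lambda>f. linform a0 * f) ` forms d \<union> U)"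
  shows "\<exists>F\<in>R3. F \<noteq> 0 \<and>
    (\<forall>a. peval F a \<noteq> 0 \<longrightarrow> forms (Suc d) \<subseteq> mp.span ((\<lambda>f. linform a * f) ` forms d \<union> U))"
proof -
  define S where "S a = (\<lambda>f. linform a * f) ` forms d \<union> U" for a
  have S: "S a \<subseteq> forms (Suc d)" for a
    using U linear_mult_forms[OF linform_forms] by (auto simp: S_def)
  obtain B where B: "B \<subseteq> S a0" "mp.independent B" "finite B" "mp.span B = mp.span (S a0)" "card B = mp.dim (S a0)"
    using mp.fin_span_basis[OF fin_span_subset_forms[OF S]] .
  have "\<exists>g. g \<in> forms d \<and> b = linform a0 * g" if "b \<in> B - U" for b
    using that B(1) by (auto simp: S_def)
  then obtain g where g: "\<And>b. b \<in> B - U \<Longrightarrow> g b \<in> forms d \<and> b = linform a0 * g b" by metis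
  \<comment> \<open>The family through \<open>b\<close>: elements of \<open>U\<close> stay fixed,
    multiples keep their cofactor \<open>g b\<close>.\<close>
  define v where "v b a = (if b \<in> U then b else linform a * g b)" for b a
  have v0: "v b a0 = b" if "b \<in> B" for b using g[of b] that by (simp add: v_def)
  have vS: "v b a \<in> S a" if "b \<in> B" for b a using g[of b] that by (auto simp: v_def S_def)
  have "(\<lambda>a. Poly_Mapping.lookup (v b a) m) \<in> poly_funs" for b m
  proof (cases "b \<in> U")
    case True
    then show ?thesis by (simp add: v_def poly_funs_const)
  next
    case False
    have "Poly_Mapping.lookup (v b a) m = (\<Sum>i<3. a i * Poly_Mapping.lookup (Xvar i * g b) m)" for a
      using False by (simp add: v_def linform_eq sum_distrib_right mult_pscale_left lookup_sum)
    then show ?thesis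
      by (simp add: numeral_3_eq_3 lessThan_Suc add.assoc)
        (intro poly_funs_add poly_funs_mult poly_funs_coord poly_funs_const; simp)
  qed
  moreover have "c i = 0" if c: "\<And>m. (\<Sum>b\<in>B. c b * Poly_Mapping.lookup (v b a0) m) = 0" and i: "i \<in> B" for c i
  proof -
    have "(\<Sum>b\<in>B. pscale (c b) b) = 0"
    proof (rule poly_mapping_eqI)
      fix m
      have "(\<Sum>b\<in>B. c b * Poly_Mapping.lookup (v b a0) m) = (\<Sum>b\<in>B. c b * Poly_Mapping.lookup b m)"
        using v0 by (intro sum.cong) auto
      then show "Poly_Mapping.lookup (\<Sum>b\<in>B. pscale (c b) b) m = Poly_Mapping.lookup 0 m"
        using c[of m] by (simp add: lookup_sum)
    qed
    then show ?thesis using B(2) i unfolding mp.dependent_finite[OF B(3)] by blast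
  qed
  ultimately obtain f where f: "f \<in> poly_funs" "f a0 \<noteq> 0"
    "\<And>a c. f a \<noteq> 0 \<Longrightarrow> (\<forall>m. (\<Sum>b\<in>B. c b * Poly_Mapping.lookup (v b a) m) = 0) \<Longrightarrow> (\<forall>b\<in>B. c b = 0)"
    using generic_independence[OF B(3), of "\<lambda>b a m. Poly_Mapping.lookup (v b a) m" a0] by blast
  from f(1) obtain F where F: "F \<in> R3" "f = peval F" unfolding poly_funs_def by blast
  have "forms (Suc d) \<subseteq> mp.span (S a)" if a: "f a \<noteq> 0" for a
  proof -
    have indep: "c i = 0" if "(\<Sum>b\<in>B. pscale (c b) (v b a)) = 0" "i \<in> B" for c i
    proof -
      have "\<forall>m. (\<Sum>b\<in>B. c b * Poly_Mapping.lookup (v b a) m) = 0"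
        using that(1)[THEN arg_cong[where f = Poly_Mapping.lookup]] by (simp add: fun_eq_iff lookup_sum)
      from f(3)[OF a this] that(2) show ?thesis by blast
    qed
    \<comment> \<open>Without collisions the image of \<open>B\<close> has \<open>card B\<close>
      elements.\<close>
    have inj: "inj_on (\<lambda>b. v b a) B"
    proof (rule inj_onI, rule ccontr)
      fix x y assume xy: "x \<in> B" "y \<in> B" "v x a = v y a" "x \<noteq> y"
      let ?c = "\<lambda>b. if b = x then 1 else if b = y then - 1 else (0 :: 'k)"
      have "(\<Sum>b\<in>B. pscale (?c b) (v b a)) = (\<Sum>b\<in>{x, y}. pscale (?c b) (v b a))"
        using xy B(3) by (intro sum.mono_neutral_right) auto
      also have "\<dots> = 0" using xy by simp
      finally have "?c x = 0" using xy(1) by (rule indep)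
      then show False by simp
    qed
    have "mp.independent ((\<lambda>b. v b a) ` B)"
    proof
      assume "mp.dependent ((\<lambda>b. v b a) ` B)"
      then obtain u where u: "\<exists>x\<in>(\<lambda>b. v b a) ` B. u x \<noteq> 0" "(\<Sum>x\<in>(\<lambda>b. v b a) ` B. pscale (u x) x) = 0"
        using B(3) by (auto simp: mp.dependent_finite)
      then have "(\<Sum>b\<in>B. pscale (u (v b a)) (v b a)) = 0"
        by (simp add: sum.reindex[OF inj])
      from indep[OF this] u(1) show False by blast
    qed
    then have "mp.dim ((\<lambda>b. v b a) ` B) = card B"
      using inj by (simp add: mp.dim_eq_card_independent card_image)
    moreover have "mp.dim ((\<lambda>b. v b a) ` B) \<le> mp.dim (S a)"
      using vS S by (intro dim_forms_mono) auto
    moreover have "mp.dim (forms (Suc d) :: 'k mpoly set) \<le> card B"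
      unfolding B(5) using surj S
      by (intro mp.dim_mono_fin fin_span_subset_forms[OF S]) (simp add: S_def)
    ultimately have "mp.span (S a) = mp.span (forms (Suc d))"
      using S by (intro mp.span_eq_of_dim_ge fin_span_forms) (auto intro: mp.span_base)
    then show ?thesis using mp.span_superset by blast
  qed
  moreover have "F \<noteq> 0" using f(2) F(2) by auto
  ultimately show ?thesis using F unfolding S_def by blast
qed

section \<open>Graded ideals\<close>

lemma (in fin_vector_space) dim_Un_finite_le:
  assumes "fin_span S" "finite C"
  shows "dim (S \<union> C) \<le> dim S + card C"
  using assms(2)
proof (induction C rule: finite_induct)
  case (insert c C)
  have "fin_span (S \<union> C)" by (rule fin_span_Un[OF assms(1) fin_span_finite[OF insert(1)]])
  from dim_insert_fin[OF this, of c] insert show ?case by simp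
qed simp

lemma subspace_mult_preimage: "mp.subspace S \<Longrightarrow> mp.subspace {g. g * f \<in> S}"
  unfolding mp.subspace_def by (simp add: distrib_right mult_pscale_left)

lemma subspace_mult_preimage': "mp.subspace S \<Longrightarrow> mp.subspace {f. g * f \<in> S}"
  unfolding mp.subspace_def by (simp add: distrib_left mult_pscale_right)

lemma subspace_image_mult: "mp.subspace S \<Longrightarrow> mp.subspace ((\<lambda>f. g * f) ` S)"
proof -
  interpret g: Vector_Spaces.linear pscale pscale "\<lambda>f. g * f" by (rule linear_mult_left)
  show "mp.subspace S \<Longrightarrow> mp.subspace ((\<lambda>f. g * f) ` S)" by (rule g.subspace_image)
qed

text \<open>A linear change of coordinates without substitution: spanning the three variables makes
  \<open>l\<close>, \<open>y\<close>, \<open>z\<close> a basis of the linear forms.\<close>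

definition linear_gens :: "'k::field mpoly \<Rightarrow> 'k mpoly \<Rightarrow> 'k mpoly \<Rightarrow> bool" where
  "linear_gens l y z \<longleftrightarrow> {l, y, z} \<subseteq> forms 1 \<and> (\<forall>i<3. Xvar i \<in> mp.span {l, y, z})"

text \<open>Multipliers carrying \<open>f\<close> into \<open>S\<close> form a subspace, so the
  socle condition on variables may be tested on \<open>l\<close>, \<open>y\<close>,
  \<open>z\<close>.\<close>

lemma linear_gens_mem:
  assumes "linear_gens l y z" "mp.subspace S" "l * f \<in> S" "y * f \<in> S" "z * f \<in> S" "i < 3"
  shows "Xvar i * f \<in> S"
proof -
  have "mp.span {l, y, z} \<subseteq> {g. g * f \<in> S}"
    using assms by (intro mp.span_minimal subspace_mult_preimage) auto
  then show ?thesis using assms(1,6) by (auto simp: linear_gens_def)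
qed

lemma linear_gens_swap: "linear_gens l y z \<Longrightarrow> linear_gens l z y"
  by (simp add: linear_gens_def insert_commute)

lemma linear_gens_forms:
  assumes "linear_gens l y z"
  shows "l \<in> forms 1" "y \<in> forms 1" "z \<in> forms 1"
  using assms by (auto simp: linear_gens_def)

lemma forms_one_span: "forms 1 \<subseteq> mp.span {Xvar 0, Xvar 1, Xvar 2 :: 'k::field mpoly}"
  unfolding forms_one linform_eq
  by (auto intro!: mp.span_add mp.span_scale intro: mp.span_base simp: numeral_3_eq_3 numeral_2_eq_2 lessThan_Suc)

text \<open>Exchange: \<open>l\<close> replaces the first variable that occurs in it.\<close>

lemma linear_gens_exist:
  assumes l: "l \<in> forms 1" "l \<noteq> (0 :: 'k::field mpoly)"
  obtains y z where "linear_gens l y z"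
proof -
  let ?X = "Xvar :: nat \<Rightarrow> 'k mpoly"
  have X: "?X 0 \<in> forms 1" "?X 1 \<in> forms 1" "?X 2 \<in> forms 1" by (simp_all only: Xvar_forms)
  have gens: "linear_gens l y z"
    if "y \<in> forms 1" "z \<in> forms 1" "?X 0 \<in> mp.span {l, y, z}" "?X 1 \<in> mp.span {l, y, z}" "?X 2 \<in> mp.span {l, y, z}"
    for y z
    unfolding linear_gens_def
  proof (intro conjI allI impI)
    fix i :: nat assume "i < 3"
    then have "i = 0 \<or> i = 1 \<or> i = 2" by auto
    then show "?X i \<in> mp.span {l, y, z}" using that(3-5) by blast
  qed (use that l in blast)
  have base: "x \<in> mp.span {l, y, z}" if "x = y \<or> x = z" for x y z
    by (rule mp.span_base) (use that in blast)
  have mono: "x \<in> mp.span {l, y, z}" if "x \<in> mp.span A" "A \<subseteq> {l, y, z}" for x y z A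
    using mp.span_mono[OF that(2)] that(1) by blast
  show thesis
  proof (cases "l \<in> mp.span {?X 1, ?X 2}")
    case False
    with subsetD[OF forms_one_span l(1)] have "?X 0 \<in> mp.span {l, ?X 1, ?X 2}"
      by (rule mp.in_span_insert)
    from that[OF gens[OF X(2,3) this base base]] show ?thesis by blast
  next
    case in12: True
    show ?thesis
    proof (cases "l \<in> mp.span {?X 2}")
      case False
      with in12 have "?X 1 \<in> mp.span {l, ?X 2}" by (rule mp.in_span_insert)
      then have "?X 1 \<in> mp.span {l, ?X 0, ?X 2}" by (rule mono) blast
      from that[OF gens[OF X(1,3) base this base]] show ?thesis by blast
    next
      case True
      have "l \<notin> mp.span {}" using l(2) by simp
      with True have "?X 2 \<in> mp.span {l}" by (rule mp.in_span_insert)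
      then have "?X 2 \<in> mp.span {l, ?X 0, ?X 1}" by (rule mono) blast
      from that[OF gens[OF X(1,2) base base this]] show ?thesis by blast
    qed
  qed
qed

text \<open>Modulo \<open>l\<close> every form is binary in \<open>y\<close> and \<open>z\<close>.
  The case distinction is there because in degree 0 there is no lower degree to multiply
  from.\<close>

lemma forms_binary_span:
  fixes l :: "'k::field mpoly"
  assumes gens: "linear_gens l y z"
  shows "forms n \<subseteq> mp.span ((case n of 0 \<Rightarrow> {} | Suc m \<Rightarrow> (\<lambda>f. l * f) ` forms m) \<union> (\<lambda>i. y ^ i * z ^ (n - i)) ` {..n})"
    (is "_ \<subseteq> mp.span (?T n)")
proof (induction n)
  case 0
  show ?case by (simp add: forms_zero)
next
  case (Suc n)
  note lyz = linear_gens_forms[OF gens]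
  show ?case
  proof (rule forms_Suc_subset[OF mp.subspace_span])
    fix i :: nat and f :: "'k mpoly" assume i: "i < 3" and f: "f \<in> forms n"
    have closed: "g * f \<in> mp.span (?T (Suc n))" if "\<And>t. t \<in> ?T n \<Longrightarrow> g * t \<in> mp.span (?T (Suc n))" for g
    proof -
      have "mp.span (?T n) \<subseteq> {f. g * f \<in> mp.span (?T (Suc n))}"
        using that by (intro mp.span_minimal subspace_mult_preimage' mp.subspace_span) blast
      then show ?thesis using Suc f by blast
    qed
    have image: "g * t \<in> mp.span (?T (Suc n))"
      if t: "t \<in> (case n of 0 \<Rightarrow> {} | Suc m \<Rightarrow> (\<lambda>f. l * f) ` forms m)" and g: "g \<in> forms 1" for g t
    proof -
      obtain m f' where f': "n = Suc m" "t = l * f'" "f' \<in> forms m" using t by (cases n) auto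
      have "g * t = l * (g * f')" unfolding f'(2) by (rule mult.left_commute)
      moreover have "g * f' \<in> forms n" unfolding f'(1) using g f'(3) by (rule linear_mult_forms)
      ultimately show ?thesis by (intro mp.span_base) auto
    qed
    have "l * f \<in> mp.span (?T (Suc n))" using f by (intro mp.span_base) auto
    moreover have "y * f \<in> mp.span (?T (Suc n))"
    proof (rule closed)
      fix t assume "t \<in> ?T n"
      then consider "t \<in> (case n of 0 \<Rightarrow> {} | Suc m \<Rightarrow> (\<lambda>f. l * f) ` forms m)" | j where "j \<le> n" "t = y ^ j * z ^ (n - j)"
        by blast
      then show "y * t \<in> mp.span (?T (Suc n))"
      proof cases
        case 2
        then have "y * t = y ^ Suc j * z ^ (Suc n - Suc j)" by (simp add: mult_ac)
        then show ?thesis using 2(1) by (intro mp.span_base UnI2 image_eqI[of _ _ "Suc j"]) auto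
      qed (rule image[OF _ lyz(2)])
    qed
    moreover have "z * f \<in> mp.span (?T (Suc n))"
    proof (rule closed)
      fix t assume "t \<in> ?T n"
      then consider "t \<in> (case n of 0 \<Rightarrow> {} | Suc m \<Rightarrow> (\<lambda>f. l * f) ` forms m)" | j where "j \<le> n" "t = y ^ j * z ^ (n - j)"
        by blast
      then show "z * t \<in> mp.span (?T (Suc n))"
      proof cases
        case 2
        then have "z * t = y ^ j * z ^ (Suc n - j)" by (simp add: mult_ac Suc_diff_le)
        then show ?thesis using 2(1) by (intro mp.span_base UnI2 image_eqI[of _ _ j]) auto
      qed (rule image[OF _ lyz(3)])
    qed
    ultimately show "Xvar i * f \<in> mp.span (?T (Suc n))"
      using linear_gens_mem[OF gens mp.subspace_span] i by blast
  qed
qed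

text \<open>Modulo \<open>y - t z\<close> one has \<open>y = t z\<close>, and so
  \<open>y ^ i\<close> may be replaced by \<open>t ^ i z ^ i\<close>.\<close>

lemma binary_monomial_mod:
  assumes "y \<in> forms 1" "z \<in> forms 1" "i \<le> Suc n"
  shows "y ^ i * z ^ (Suc n - i) - pscale (t ^ i) (z ^ Suc n) \<in> (\<lambda>f. (y - pscale t z) * f) ` forms n"
    (is "_ \<in> ?M")
  using assms(3)
proof (induction i)
  case 0
  show ?case by (intro image_eqI[of _ _ 0]) (simp_all add: mp.subspace_0[OF subspace_forms])
next
  case (Suc i)
  let ?f = "y ^ i * z ^ (n - i)"
  have "?f \<in> forms (i + (n - i))" using assms by (intro forms_mult forms_power)
  then have "?f \<in> forms n" using Suc.prems by simp
  then have "(y - pscale t z) * ?f \<in> ?M" by (rule imageI)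
  moreover have "pscale t (y ^ i * z ^ (Suc n - i) - pscale (t ^ i) (z ^ Suc n)) \<in> ?M"
    using Suc by (intro mp.subspace_scale[OF subspace_image_mult[OF subspace_forms]]) simp
  moreover have "y ^ Suc i * z ^ (Suc n - Suc i) - pscale (t ^ Suc i) (z ^ Suc n) =
      (y - pscale t z) * ?f + pscale t (y ^ i * z ^ (Suc n - i) - pscale (t ^ i) (z ^ Suc n))"
  proof -
    have "y * a - pscale (t * c) b = (y - pscale t z) * a + pscale t (z * a - pscale c b)" for a b c
      by (simp add: left_diff_distrib mult_pscale_left mp.scale_right_diff_distrib)
    moreover have "y ^ i * z ^ (Suc n - i) = z * ?f" "y ^ Suc i * z ^ (Suc n - Suc i) = y * ?f"
      using Suc.prems by (simp_all add: Suc_diff_le mult_ac)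
    ultimately show ?thesis by (simp only: power_Suc)
  qed
  ultimately show ?case
    using mp.subspace_add[OF subspace_image_mult[OF subspace_forms]] by simp
qed

section \<open>Multiplication by a linear form on the graded pieces\<close>

locale graded_ideal =
  fixes I :: "'k::field_char_0 mpoly set"
  assumes hom: "homogeneous_ideal I"
begin

lemma I_mult: "r \<in> R3 \<Longrightarrow> p \<in> I \<Longrightarrow> r * p \<in> I"
  and I_hcomp: "p \<in> I \<Longrightarrow> hcomp d p \<in> I"
  using hom by (auto simp: homogeneous_ideal_def is_ideal_def)

lemma I_mult_linear: "l \<in> forms 1 \<Longrightarrow> p \<in> I \<Longrightarrow> l * p \<in> I"
  using I_mult forms_subset_R3 by blast

lemma subspace_I: "mp.subspace I"
  using hom I_mult unfolding mp.subspace_def homogeneous_ideal_def is_ideal_def pscale_conv_mult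
  by (auto simp: R3_single)

definition gr :: "nat \<Rightarrow> 'k mpoly set" where
  "gr d = I \<inter> forms d"

text \<open>Quotients are avoided: \<open>im l d\<close> spans the part of \<open>I + (l)\<close> in
  degree \<open>Suc d\<close>, and \<open>ker l d\<close> is the preimage in \<open>forms d\<close>
  of the kernel on the quotient.\<close>

definition im :: "'k mpoly \<Rightarrow> nat \<Rightarrow> 'k mpoly set" where
  "im l d = (\<lambda>f. l * f) ` forms d \<union> gr (Suc d)"

definition ker :: "'k mpoly \<Rightarrow> nat \<Rightarrow> 'k mpoly set" where
  "ker l d = {f \<in> forms d. l * f \<in> I}"

definition surj_at :: "'k mpoly \<Rightarrow> nat \<Rightarrow> bool" where
  "surj_at l d \<longleftrightarrow> forms (Suc d) \<subseteq> mp.span (im l d)"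

lemma subspace_gr: "mp.subspace (gr d)"
  unfolding gr_def using subspace_I subspace_forms by (rule mp.subspace_inter)

lemma gr_subset: "gr d \<subseteq> forms d"
  by (simp add: gr_def)

lemma ker_subset: "ker l d \<subseteq> forms d"
  by (auto simp: ker_def)

lemma subspace_ker: "mp.subspace (ker l d)"
proof -
  have "ker l d = forms d \<inter> {f. l * f \<in> I}" by (auto simp: ker_def)
  then show ?thesis
    using mp.subspace_inter[OF subspace_forms subspace_mult_preimage'[OF subspace_I]] by simp
qed

lemma gr_subset_ker: "l \<in> forms 1 \<Longrightarrow> gr d \<subseteq> ker l d"
  by (auto simp: gr_def ker_def I_mult_linear)

lemma im_subset: "l \<in> forms 1 \<Longrightarrow> im l d \<subseteq> forms (Suc d)"
  using linear_mult_forms by (auto simp: im_def gr_def)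

text \<open>Replaces the truncated subtraction in \<open>hilb\<close> by a sum.\<close>

lemma hilb_add_dim: "hilb I d + mp.dim (gr d) = mp.dim (forms d :: 'k mpoly set)"
  using dim_forms_mono[OF gr_subset subset_refl, of d] by (simp add: hilb_def kdim_eq_dim gr_def)

lemma span_im: "mp.span (im l d) = {l * f + g | f g. f \<in> forms d \<and> g \<in> gr (Suc d)}"
proof -
  have eq: "mp.span ((\<lambda>f. l * f) ` forms d) = (\<lambda>f. l * f) ` forms d" "mp.span (gr (Suc d)) = gr (Suc d)"
    using subspace_image_mult[OF subspace_forms] subspace_gr by simp_all
  show ?thesis unfolding im_def mp.span_Un eq by blast
qed

lemma surj_at_iff: "surj_at l d \<longleftrightarrow> mult_surj I l d" if l: "l \<in> forms 1"
proof
  assume "surj_at l d"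
  then have "\<exists>f h. g = l * f + h \<and> f \<in> forms d \<and> h \<in> gr (Suc d)" if "g \<in> forms (Suc d)" for g
    using that unfolding surj_at_def span_im by blast
  then show "mult_surj I l d"
    unfolding mult_surj_def gr_def by (metis IntE add_diff_cancel_left')
next
  assume s: "mult_surj I l d"
  show "surj_at l d"
    unfolding surj_at_def span_im
  proof
    fix g :: "'k mpoly" assume g: "g \<in> forms (Suc d)"
    then obtain f where f: "f \<in> forms d" "g - l * f \<in> I" using s by (auto simp: mult_surj_def)
    have "g - l * f \<in> gr (Suc d)"
      using f g linear_mult_forms[OF l] by (simp add: gr_def mp.subspace_diff[OF subspace_forms])
    moreover have "g = l * f + (g - l * f)" by simp
    ultimately show "g \<in> {l * f + g | f g. f \<in> forms d \<and> g \<in> gr (Suc d)}" using f by blast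
  qed
qed

lemma dim_image_restrict:
  assumes "g \<in> forms 1" "mp.subspace V" "V \<subseteq> forms d"
  shows "mp.dim V + mp.dim (gr (Suc d)) =
    mp.dim {v \<in> V. g * v \<in> I} + mp.dim ((\<lambda>f. g * f) ` V \<union> gr (Suc d))"
proof -
  have "{v \<in> V. g * v \<in> I} = {v \<in> V. g * v \<in> gr (Suc d)}"
    using assms linear_mult_forms by (auto simp: gr_def)
  then show ?thesis
    using mp.dim_preimage_plus_image[OF linear_mult_left assms(2) fin_span_subset_forms[OF assms(3)]
      subspace_gr fin_span_subset_forms[OF gr_subset]] by simp
qed

lemma dim_ker_im:
  assumes "l \<in> forms 1"
  shows "mp.dim (forms d :: 'k mpoly set) + mp.dim (gr (Suc d)) = mp.dim (ker l d) + mp.dim (im l d)"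
  using dim_image_restrict[OF assms subspace_forms subset_refl, of d] by (simp add: ker_def im_def)

lemma surj_at_dim: "l \<in> forms 1 \<Longrightarrow> surj_at l d \<Longrightarrow> mp.dim (im l d) = mp.dim (forms (Suc d) :: 'k mpoly set)"
  unfolding surj_at_def
  using dim_forms_mono[OF im_subset subset_refl, of l d]
    mp.dim_mono_fin[OF fin_span_subset_forms[OF im_subset], of l "forms (Suc d)" d] by simp

lemma surj_at_hilb:
  assumes "l \<in> forms 1" "surj_at l d"
  shows "mp.dim (ker l d) + hilb I (Suc d) = mp.dim (gr d) + hilb I d"
  using dim_ker_im[OF assms(1), of d] surj_at_dim[OF assms] hilb_add_dim[of d] hilb_add_dim[of "Suc d"]
  by linarith

lemma surj_at_hilb_le:
  assumes "l \<in> forms 1" "surj_at l d"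
  shows "hilb I (Suc d) \<le> hilb I d"
  using surj_at_hilb[OF assms] dim_forms_mono[OF gr_subset_ker[OF assms(1)] ker_subset, of d] by linarith

lemma inj_ker: "mult_inj I l d \<Longrightarrow> l \<in> forms 1 \<Longrightarrow> ker l d = gr d"
  using gr_subset_ker by (auto simp: mult_inj_def ker_def gr_def)

lemma inj_at_hilb:
  assumes "l \<in> forms 1" "mult_inj I l d"
  shows "hilb I d + mp.dim (gr (Suc d)) = mp.dim (im l d)"
  using dim_ker_im[OF assms(1), of d] inj_ker[OF assms(2,1)] hilb_add_dim[of d] by simp

lemma inj_imp_surj:
  assumes "l \<in> forms 1" "mult_inj I l d" "hilb I (Suc d) \<le> hilb I d"
  shows "surj_at l d"
proof -
  have "mp.span (im l d) = mp.span (forms (Suc d))"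
    using inj_at_hilb[OF assms(1,2)] hilb_add_dim[of "Suc d"] assms(3) im_subset[OF assms(1)]
    by (intro mp.span_eq_of_dim_ge fin_span_forms) (auto intro: mp.span_base)
  then show ?thesis unfolding surj_at_def using mp.span_superset by blast
qed

text \<open>The quotient by \<open>I + (l)\<close> is generated in degree 0, so once it vanishes in
  a degree it vanishes in the next.\<close>

lemma surj_at_Suc:
  assumes "l \<in> forms 1" "surj_at l d"
  shows "surj_at l (Suc d)"
  unfolding surj_at_def
proof (rule forms_Suc_subset[OF mp.subspace_span])
  fix i :: nat and f :: "'k mpoly" assume i: "i < 3" and "f \<in> forms (Suc d)"
  then obtain f' g where f: "f = l * f' + g" "f' \<in> forms d" "g \<in> gr (Suc d)"
    using assms(2) unfolding surj_at_def span_im by blast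
  have "Xvar i * f = l * (Xvar i * f') + Xvar i * g" by (simp add: f distrib_left mult_ac)
  moreover have "Xvar i * f' \<in> forms (Suc d)" "Xvar i * g \<in> gr (Suc (Suc d))"
    using f Xvar_forms[OF i] unfolding gr_def by (blast intro: linear_mult_forms I_mult_linear)+
  ultimately show "Xvar i * f \<in> mp.span (im l (Suc d))" unfolding span_im by blast
qed

lemma surj_at_mono:
  assumes "l \<in> forms 1" "surj_at l d" "d \<le> e"
  shows "surj_at l e"
  using assms(3)
proof (induction rule: dec_induct)
  case (step n)
  then show ?case using surj_at_Suc[OF assms(1)] by blast
qed (rule assms(2))

text \<open>The Hilbert function of the quotient by \<open>I + (l)\<close>, provided that \<open>I\<close> is proper.\<close>
definition cod :: "'k mpoly \<Rightarrow> nat \<Rightarrow> nat" where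
  "cod l n = (case n of 0 \<Rightarrow> 1 | Suc m \<Rightarrow> mp.dim (forms n :: 'k mpoly set) - mp.dim (im l m))"

text \<open>The \<open>n + 1\<close> binary monomials in \<open>y\<close> and \<open>z\<close> span
  the quotient.\<close>

lemma cod_le:
  assumes gens: "linear_gens l y z"
  shows "cod l n \<le> n + 1"
proof (cases n)
  case (Suc m)
  let ?E = "(\<lambda>i. y ^ i * z ^ (Suc m - i)) ` {..Suc m}"
  have fin: "mp.fin_span (im l m)"
    using im_subset linear_gens_forms(1)[OF gens] by (intro fin_span_subset_forms)
  have "(\<lambda>f. l * f) ` forms m \<union> ?E \<subseteq> im l m \<union> ?E" by (auto simp: im_def)
  then have "forms (Suc m) \<subseteq> mp.span (im l m \<union> ?E)"
    using forms_binary_span[OF gens, of "Suc m"] unfolding nat.case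
    by (rule order_trans[OF _ mp.span_mono, rotated])
  then have "mp.dim (forms (Suc m) :: 'k mpoly set) \<le> mp.dim (im l m \<union> ?E)"
    by (intro mp.dim_mono_fin mp.fin_span_Un[OF fin mp.fin_span_finite]) auto
  also have "\<dots> \<le> mp.dim (im l m) + card ?E" using fin by (intro mp.dim_Un_finite_le) auto
  also have "card ?E \<le> m + 2" using card_image_le[of "{..Suc m}"] by (simp add: le_trans)
  finally show ?thesis using Suc by (simp add: cod_def)
qed (simp add: cod_def)

text \<open>If the binary Hilbert function has dropped below its maximum, then \<open>I + (l)\<close> contains a form
  of that degree outside \<open>(l)\<close>; a linear form \<open>y - t z\<close> not dividing it modulo \<open>l\<close> acts
  surjectively from then on.\<close>
lemma cod_step:
  assumes gens: "linear_gens l y z" and small: "cod l n \<le> n"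
  shows "cod l (Suc n) \<le> cod l n"
proof (cases n)
  case 0
  then show ?thesis using small by (simp add: cod_def)
next
  case (Suc m)
  note lyz = linear_gens_forms[OF gens]
  let ?J = "im l m" and ?e = "\<lambda>i. y ^ i * z ^ (Suc m - i)"
  have J: "?J \<subseteq> forms (Suc m)" by (rule im_subset[OF lyz(1)])
  have fin: "mp.fin_span ?J" using J by (rule fin_span_subset_forms)
  have e: "?e i \<in> forms (Suc m)" if "i \<le> Suc m" for i
    using forms_mult[OF forms_power[OF lyz(2)] forms_power[OF lyz(3)], of i "Suc m - i"] that by simp
  \<comment> \<open>Otherwise all \<open>m + 2\<close> binary monomials would be independent modulo
    \<open>?J\<close>, against \<open>cod l n \<le> n\<close>.\<close>
  have "\<exists>k\<le>Suc m. ?e k \<in> mp.span (?J \<union> ?e ` {..<k})"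
  proof (rule ccontr)
    assume none: "\<not> ?thesis"
    have "mp.dim (?J \<union> ?e ` {..<k}) = mp.dim ?J + k" if "k \<le> Suc (Suc m)" for k
      using that
    proof (induction k)
      case (Suc k)
      have "?J \<union> ?e ` {..<Suc k} = insert (?e k) (?J \<union> ?e ` {..<k})" by (auto simp: lessThan_Suc)
      moreover have "mp.fin_span (?J \<union> ?e ` {..<k})"
        by (intro mp.fin_span_Un[OF fin mp.fin_span_finite]) simp
      ultimately show ?case
        using Suc none mp.dim_insert_fin[of "?J \<union> ?e ` {..<k}" "?e k"] by simp
    qed simp
    then have "mp.dim (?J \<union> ?e ` {..<Suc (Suc m)}) = mp.dim ?J + Suc (Suc m)" by blast
    moreover have "mp.dim (?J \<union> ?e ` {..<Suc (Suc m)}) \<le> mp.dim (forms (Suc m) :: 'k mpoly set)"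
      using J e by (intro dim_forms_mono[OF _ subset_refl]) auto
    ultimately show False using small Suc by (simp add: cod_def)
  qed
  then obtain k where k: "k \<le> Suc m" "?e k \<in> mp.span (?J \<union> ?e ` {..<k})" by blast
  then obtain j v where jv: "?e k = j + v" "j \<in> mp.span ?J" "v \<in> mp.span (?e ` {..<k})"
    unfolding mp.span_Un by blast
  \<comment> \<open>The part of degree \<open>Suc m\<close> of the ideal of \<open>y - t z\<close>;
    modulo it binary monomials become multiples of \<open>z ^ Suc m\<close>.\<close>
  define M where "M t = (\<lambda>f. (y - pscale t z) * f) ` forms m" for t
  have M: "mp.subspace (M t)" for t unfolding M_def by (rule subspace_image_mult[OF subspace_forms])
  have mod: "?e i - pscale (t ^ i) (z ^ Suc m) \<in> M t" if "i \<le> Suc m" for i t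
    unfolding M_def using lyz(2,3) that by (rule binary_monomial_mod)
  \<comment> \<open>The elements that become \<open>q(t) z ^ Suc m\<close> for a polynomial
    \<open>q\<close> in \<open>t\<close> without a term of degree \<open>k\<close>; the monomials
    with index below \<open>k\<close> are such.\<close>
  let ?P = "{v. \<exists>q. coeff q k = 0 \<and> (\<forall>t. v - pscale (poly q t) (z ^ Suc m) \<in> M t)}"
  have "mp.span (?e ` {..<k}) \<subseteq> ?P"
  proof (rule mp.span_minimal)
    show "?e ` {..<k} \<subseteq> ?P"
    proof
      fix x assume "x \<in> ?e ` {..<k}"
      then obtain i where "i < k" "x = ?e i" by blast
      then show "x \<in> ?P"
        using mod[of i] k(1) by (intro CollectI exI[of _ "monom 1 i"]) (simp add: poly_monom)
    qed
    show "mp.subspace ?P"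
      unfolding mp.subspace_def
    proof (intro conjI ballI allI)
      show "0 \<in> ?P" using M by (intro CollectI exI[of _ 0]) (simp add: mp.subspace_0)
    next
      fix u w assume "u \<in> ?P" "w \<in> ?P"
      then obtain p q where p: "coeff p k = 0" "\<And>t. u - pscale (poly p t) (z ^ Suc m) \<in> M t"
        and q: "coeff q k = 0" "\<And>t. w - pscale (poly q t) (z ^ Suc m) \<in> M t" by blast
      have "u + w - pscale (poly (p + q) t) (z ^ Suc m) \<in> M t" for t
        using mp.subspace_add[OF M p(2) q(2), of t] by (simp only: poly_add mp.scale_left_distrib add_diff_add)
      then show "u + w \<in> ?P" using p(1) q(1) by (intro CollectI exI[of _ "p + q"]) simp
    next
      fix c u assume "u \<in> ?P"
      then obtain p where p: "coeff p k = 0" "\<And>t. u - pscale (poly p t) (z ^ Suc m) \<in> M t" by blast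
      have "pscale c u - pscale (poly (smult c p) t) (z ^ Suc m) \<in> M t" for t
        using mp.subspace_scale[OF M p(2), of c t] by (simp only: poly_smult mp.scale_right_diff_distrib mp.scale_scale)
      then show "pscale c u \<in> ?P" using p(1) by (intro CollectI exI[of _ "smult c p"]) simp
    qed
  qed
  with jv(3) obtain q where q: "coeff q k = 0" "\<And>t. v - pscale (poly q t) (z ^ Suc m) \<in> M t" by blast
  \<comment> \<open>Modulo \<open>M t\<close> the element \<open>j\<close> becomes
    \<open>p(t) z ^ Suc m\<close>, and \<open>p\<close> is nonzero because \<open>q\<close> cannot
    cancel its term of degree \<open>k\<close>.\<close>
  define p where "p = monom 1 k - q"
  have "coeff p k = 1" using q(1) by (simp add: p_def)
  then have "p \<noteq> 0" by auto
  then have "finite {t. poly p t = 0}" by (rule poly_roots_finite)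
  then obtain t where t: "poly p t \<noteq> 0" using ex_new_if_finite[OF infinite_UNIV_char_0] by blast
  define S where "S = mp.span (?J \<union> M t)"
  have S: "mp.subspace S" "M t \<subseteq> S" "mp.span ?J \<subseteq> S" "?J \<subseteq> S"
    unfolding S_def by (auto intro: mp.span_base simp: mp.span_mono)
  have "(v - pscale (poly q t) (z ^ Suc m)) - (?e k - pscale (t ^ k) (z ^ Suc m)) + j \<in> S"
    by (rule mp.subspace_add[OF S(1) mp.subspace_diff[OF S(1)]])
      (use mod[OF k(1), of t] q(2)[of t] jv(2) S(2,3) in blast)+
  moreover have "(v - pscale (poly q t) (z ^ Suc m)) - (?e k - pscale (t ^ k) (z ^ Suc m)) + j = pscale (poly p t) (z ^ Suc m)"
    unfolding jv(1) by (simp add: p_def poly_monom mp.scale_left_diff_distrib)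
  ultimately have "pscale (poly p t) (z ^ Suc m) \<in> S" by (simp only:)
  from mp.subspace_scale[OF S(1) this, of "inverse (poly p t)"]
  have z: "z ^ Suc m \<in> S" using t by (simp del: power_Suc)
  have "?e i \<in> S" if "i \<le> Suc m" for i
  proof -
    have "(?e i - pscale (t ^ i) (z ^ Suc m)) + pscale (t ^ i) (z ^ Suc m) \<in> S"
      using mod[OF that, of t] S(2) by (intro mp.subspace_add[OF S(1) _ mp.subspace_scale[OF S(1) z]]) blast
    then show ?thesis by (simp only: diff_add_cancel)
  qed
  then have "?e ` {..Suc m} \<subseteq> S" by blast
  moreover have "(\<lambda>f. l * f) ` forms m \<subseteq> S" using S(4) unfolding im_def by blast
  ultimately have "mp.span ((\<lambda>f. l * f) ` forms m \<union> ?e ` {..Suc m}) \<subseteq> S"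
    by (intro mp.span_minimal[OF _ S(1)] Un_least)
  then have forms_S: "forms (Suc m) \<subseteq> S"
    using forms_binary_span[OF gens, of "Suc m"] unfolding nat.case by (rule order_trans[rotated])
  let ?l = "y - pscale t z" and ?U = "mp.span (im l (Suc m))"
  have l': "?l \<in> forms 1"
    using lyz by (intro mp.subspace_diff[OF subspace_forms] mp.subspace_scale[OF subspace_forms])
  let ?T = "mp.span ((\<lambda>f. ?l * f) ` forms (Suc m) \<union> ?U)"
  have mult_J: "g * x \<in> ?U" if x: "x \<in> ?J" and g: "g \<in> forms 1" for g x
  proof -
    consider f where "f \<in> forms m" "x = l * f" | "x \<in> gr (Suc m)" using x unfolding im_def by blast
    then have "g * x \<in> im l (Suc m)"
    proof cases
      case 1
      have "g * x = l * (g * f)" unfolding 1(2) by (rule mult.left_commute)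
      then show ?thesis unfolding im_def using linear_mult_forms[OF g 1(1)] by blast
    next
      case 2
      then show ?thesis unfolding im_def gr_def using linear_mult_forms[OF g] I_mult_linear[OF g] by blast
    qed
    then show ?thesis by (rule mp.span_base)
  qed
  \<comment> \<open>Since \<open>?J\<close> and \<open>M t\<close> together span degree
    \<open>Suc m\<close>, multiplication by \<open>y - t z\<close> is onto the next degree modulo
    \<open>im l (Suc m)\<close>.\<close>
  have full: "forms (Suc (Suc m)) \<subseteq> ?T"
  proof (rule forms_Suc_subset[OF mp.subspace_span])
    fix i :: nat and f :: "'k mpoly" assume i: "i < 3" and f: "f \<in> forms (Suc m)"
    have "S \<subseteq> {f. Xvar i * f \<in> ?T}"
      unfolding S_def
    proof (rule mp.span_minimal[OF _ subspace_mult_preimage'[OF mp.subspace_span]], rule subsetI)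
      fix x assume "x \<in> ?J \<union> M t"
      then consider "x \<in> ?J" | f' where "f' \<in> forms m" "x = ?l * f'" unfolding M_def by blast
      then have "Xvar i * x \<in> (\<lambda>f. ?l * f) ` forms (Suc m) \<union> ?U"
      proof cases
        case 1
        then show ?thesis using mult_J[OF _ Xvar_forms[OF i]] by blast
      next
        case 2
        have "Xvar i * x = ?l * (Xvar i * f')" unfolding 2(2) by (rule mult.left_commute)
        then show ?thesis using linear_mult_forms[OF Xvar_forms[OF i] 2(1)] by blast
      qed
      then show "x \<in> {f. Xvar i * f \<in> ?T}" by (blast intro: mp.span_base)
    qed
    then show "Xvar i * f \<in> ?T" using f forms_S by blast
  qed
  have U: "?U \<subseteq> forms (Suc (Suc m))"
    by (intro mp.span_minimal[OF im_subset[OF lyz(1)] subspace_forms])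
  \<comment> \<open>Rank-nullity for this map; its kernel contains \<open>?J\<close>.\<close>
  have "mp.dim (forms (Suc m) :: 'k mpoly set) + mp.dim ?U =
      mp.dim {v \<in> forms (Suc m). ?l * v \<in> ?U} + mp.dim ((\<lambda>f. ?l * f) ` forms (Suc m) \<union> ?U)"
    by (rule mp.dim_preimage_plus_image[OF linear_mult_left subspace_forms fin_span_forms mp.subspace_span
      fin_span_subset_forms[OF U]])
  moreover have "mp.dim ?J \<le> mp.dim {v \<in> forms (Suc m). ?l * v \<in> ?U}"
    using J mult_J[OF _ l'] by (intro dim_forms_mono[of _ _ "Suc m"]) blast+
  moreover have "mp.dim (forms (Suc (Suc m)) :: 'k mpoly set) \<le> mp.dim ((\<lambda>f. ?l * f) ` forms (Suc m) \<union> ?U)"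
    by (intro mp.dim_mono_fin[OF fin_span_subset_forms[of _ "Suc (Suc m)"] full])
      (use U linear_mult_forms[OF l'] in blast)
  ultimately have "mp.dim (forms (Suc (Suc m)) :: 'k mpoly set) + mp.dim ?J \<le> mp.dim (forms (Suc m) :: 'k mpoly set) + mp.dim (im l (Suc m))"
    unfolding mp.dim_span by linarith
  then show ?thesis using Suc by (simp add: cod_def)
qed

lemma cod_binary_O_sequence: "linear_gens l y z \<Longrightarrow> binary_O_sequence (cod l)"
  by unfold_locales (simp add: cod_def, rule cod_le, assumption, rule cod_step, assumption)

section \<open>Vanishing degrees, the socle, and the decreasing part of the Hilbert function\<close>

lemma hilb_eq_0_iff: "hilb I d = 0 \<longleftrightarrow> forms d \<subseteq> I"
proof
  assume "hilb I d = 0"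
  then have "gr d = forms d"
    using hilb_add_dim[of d] by (intro subspace_forms_eqI[OF subspace_gr subspace_forms gr_subset subset_refl]) simp
  then show "forms d \<subseteq> I" by (auto simp: gr_def)
next
  assume "forms d \<subseteq> I"
  then have "gr d = forms d" by (auto simp: gr_def)
  then show "hilb I d = 0" using hilb_add_dim[of d] by simp
qed

lemma hilb_Suc_eq_0:
  assumes "hilb I d = 0"
  shows "hilb I (Suc d) = 0"
  using assms unfolding hilb_eq_0_iff
  by (intro forms_Suc_subset[OF subspace_I]) (use I_mult_linear[OF Xvar_forms] in blast)

lemma hilb_eq_0_mono:
  assumes "hilb I d = 0" "d \<le> e"
  shows "hilb I e = 0"
  using assms(2)
proof (induction rule: dec_induct)
  case (step n)
  then show ?case using hilb_Suc_eq_0 by blast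
qed (rule assms(1))

text \<open>The maximal ideal is generated by the variables, so they suffice to detect socle
  elements.\<close>

lemma mult_max_ideal:
  assumes f: "\<And>i. i < 3 \<Longrightarrow> Xvar i * f \<in> I" and p: "p \<in> max_ideal"
  shows "f * p \<in> I"
proof -
  let ?s = "\<lambda>m. Poly_Mapping.single m (Poly_Mapping.lookup p m)"
  have "f * ?s m \<in> I" if m: "m \<in> Poly_Mapping.keys p" for m
  proof -
    have "m \<noteq> 0" using m p by (auto simp: max_ideal_def in_keys_iff)
    moreover have "Poly_Mapping.keys m \<subseteq> {0,1,2}" using m p by (auto simp: max_ideal_def R3_def)
    ultimately obtain i n where i: "i < 3" "Poly_Mapping.keys n \<subseteq> {0,1,2}"
      "\<And>c :: 'k. Poly_Mapping.single m c = Xvar i * Poly_Mapping.single n c"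
      using single_eq_Xvar_mult[of m, where ?'k = 'k] by blast
    have "f * ?s m = Poly_Mapping.single n (Poly_Mapping.lookup p m) * (Xvar i * f)"
      unfolding i(3) by (simp only: mult_ac)
    moreover have "Poly_Mapping.single n (Poly_Mapping.lookup p m) \<in> R3"
      using i(2) by (simp add: R3_single)
    ultimately show ?thesis using I_mult[OF _ f[OF i(1)]] by (simp only:)
  qed
  then have "(\<Sum>m\<in>Poly_Mapping.keys p. f * ?s m) \<in> I"
    by (rule mp.subspace_sum[OF subspace_I])
  then show ?thesis by (simp only: sum_distrib_left[symmetric] sum_single_lookup)
qed

text \<open>In degree \<open>s\<close> everything is annihilated by the variables, so the one socle
  degree allowed by \<open>level\<close> must be \<open>s\<close>.\<close>

lemma level_socle:
  assumes lev: "level I" and top: "hilb I s \<noteq> 0" "hilb I (Suc s) = 0"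
    and f: "f \<in> forms d" "d \<noteq> s" "\<And>i. i < 3 \<Longrightarrow> Xvar i * f \<in> I"
  shows "f \<in> I"
proof -
  obtain t where t: "\<And>f. f \<in> R3 \<Longrightarrow> \<forall>p\<in>max_ideal. f * p \<in> I \<Longrightarrow> \<exists>g\<in>forms t. f - g \<in> I"
    using lev unfolding level_def by blast
  \<comment> \<open>If \<open>u - g \<in> I\<close> with \<open>g\<close> of degree
    \<open>t\<close>, the component of degree \<open>e\<close> is \<open>u\<close> itself.\<close>
  have mem: "u \<in> I" if u: "u \<in> forms e" "e \<noteq> t" "\<And>i. i < 3 \<Longrightarrow> Xvar i * u \<in> I" for u e
  proof -
    obtain g where "g \<in> forms t" "u - g \<in> I"
      using t[of u] mult_max_ideal[OF u(3)] u(1) forms_subset_R3 by blast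
    then have "hcomp e u - hcomp e g \<in> I" using I_hcomp[of "u - g" e] by (simp add: hcomp_diff)
    then show ?thesis using \<open>g \<in> forms t\<close> u(1,2) by (simp add: hcomp_form)
  qed
  obtain u where u: "u \<in> forms s" "u \<notin> I" using top(1) unfolding hilb_eq_0_iff by blast
  have "Xvar i * u \<in> I" if "i < 3" for i
    using top(2) linear_mult_forms[OF Xvar_forms[OF that] u(1)] unfolding hilb_eq_0_iff by blast
  then have "s = t" using mem[OF u(1)] u(2) by blast
  then show ?thesis using mem f by blast
qed

text \<open>Rank-nullity for \<open>g\<close> as a map from \<open>V\<close> to \<open>W\<close>
  modulo \<open>I\<close>; if the inequality is an equality, the map is onto.\<close>

lemma dim_kernel_step:
  assumes "g \<in> forms 1" "mp.subspace V" "V \<subseteq> forms d" "mp.subspace W" "W \<subseteq> forms (Suc d)"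
    and "(\<lambda>v. g * v) ` V \<union> gr (Suc d) \<subseteq> W"
  shows "mp.dim V + mp.dim (gr (Suc d)) \<le> mp.dim {v \<in> V. g * v \<in> I} + mp.dim W"
    and "mp.dim {v \<in> V. g * v \<in> I} + mp.dim W \<le> mp.dim V + mp.dim (gr (Suc d)) \<Longrightarrow>
      w \<in> W \<Longrightarrow> \<exists>v\<in>V. w - g * v \<in> I"
proof -
  let ?T = "(\<lambda>v. g * v) ` V \<union> gr (Suc d)"
  have eq: "mp.dim V + mp.dim (gr (Suc d)) = mp.dim {v \<in> V. g * v \<in> I} + mp.dim ?T"
    by (rule dim_image_restrict[OF assms(1-3)])
  also have "mp.dim ?T \<le> mp.dim W" using assms(5,6) by (intro dim_forms_mono)
  finally show "mp.dim V + mp.dim (gr (Suc d)) \<le> mp.dim {v \<in> V. g * v \<in> I} + mp.dim W" by simp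
  assume "mp.dim {v \<in> V. g * v \<in> I} + mp.dim W \<le> mp.dim V + mp.dim (gr (Suc d))" and w: "w \<in> W"
  then have "mp.dim W \<le> mp.dim ?T" using eq by linarith
  moreover have "?T \<subseteq> mp.span W" using assms(6) mp.span_superset[of W] by blast
  ultimately have "mp.span ?T = mp.span W"
    by (intro mp.span_eq_of_dim_ge fin_span_subset_forms[OF assms(5)])
  then have "w \<in> mp.span ?T" using w mp.span_base by blast
  then obtain v h where vh: "w = v + h" "v \<in> mp.span ((\<lambda>v. g * v) ` V)" "h \<in> mp.span (gr (Suc d))"
    unfolding mp.span_Un by blast
  have span: "mp.span ((\<lambda>v. g * v) ` V) = (\<lambda>v. g * v) ` V" "mp.span (gr (Suc d)) = gr (Suc d)"
    using subspace_image_mult[OF assms(2)] subspace_gr by simp_all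
  obtain v' where "v' \<in> V" "v = g * v'" using vh(2) unfolding span(1) by blast
  moreover have "h \<in> I" using vh(3) gr_subset unfolding span(2) by (simp add: gr_def)
  ultimately have "v' \<in> V" "w = g * v' + h" "h \<in> I" using vh(1) by simp_all
  then show "\<exists>v\<in>V. w - g * v \<in> I" by (intro bexI[of _ v']) simp_all
qed

lemma subspace_restrict:
  assumes "mp.subspace V"
  shows "mp.subspace {v \<in> V. g * v \<in> I}"
  using mp.subspace_inter[OF assms subspace_mult_preimage'[OF subspace_I], of g] by (simp add: Int_def)

text \<open>The embedding by \<open>(y, z)\<close> in two stages: \<open>y\<close> on the kernel of
  \<open>l\<close>, then \<open>z\<close> on the kernel \<open>N\<close> of \<open>y\<close>
  therein, where injectivity modulo \<open>I\<close> is the socle condition. In the extremal case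
  \<open>z\<close> maps \<open>N\<close> onto \<open>ker l (Suc d)\<close> modulo \<open>I\<close>,
  so \<open>u = z v\<close> with \<open>y v \<in> I\<close>, whence
  \<open>y u \<in> I\<close>.\<close>

lemma ker_step:
  assumes gens: "linear_gens l y z"
    and soc: "\<And>f. f \<in> forms d \<Longrightarrow> (\<And>i. i < 3 \<Longrightarrow> Xvar i * f \<in> I) \<Longrightarrow> f \<in> I"
  shows "mp.dim (ker l d) + 2 * mp.dim (gr (Suc d)) \<le> mp.dim (gr d) + 2 * mp.dim (ker l (Suc d))"
    and "mp.dim (gr d) + 2 * mp.dim (ker l (Suc d)) \<le> mp.dim (ker l d) + 2 * mp.dim (gr (Suc d)) \<Longrightarrow>
      u \<in> ker l (Suc d) \<Longrightarrow> y * u \<in> I"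
proof -
  note lyz = linear_gens_forms[OF gens]
  let ?P = "ker l d" and ?Q = "ker l (Suc d)"
  define N where "N = {v \<in> ?P. y * v \<in> I}"
  have N: "mp.subspace N" "N \<subseteq> ?P" "N \<subseteq> forms d"
    unfolding N_def using subspace_restrict[OF subspace_ker] ker_subset[of l d] by blast+
  have image: "(\<lambda>v. g * v) ` V \<union> gr (Suc d) \<subseteq> ?Q" if "g \<in> forms 1" "V \<subseteq> ?P" for g V
  proof -
    have "g * v \<in> ?Q" if "v \<in> V" for v
    proof -
      have "v \<in> forms d" "l * v \<in> I" using that \<open>V \<subseteq> ?P\<close> by (auto simp: ker_def)
      moreover have "l * (g * v) = g * (l * v)" by (rule mult.left_commute)
      ultimately show ?thesis
        using linear_mult_forms[OF \<open>g \<in> forms 1\<close>] I_mult_linear[OF \<open>g \<in> forms 1\<close>, of "l * v"]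
        by (simp only: ker_def mem_Collect_eq)
    qed
    then show ?thesis using gr_subset_ker[OF lyz(1)] by blast
  qed
  \<comment> \<open>A form killed by \<open>l\<close>, \<open>y\<close> and \<open>z\<close> is a
    socle element.\<close>
  have final: "{v \<in> N. z * v \<in> I} = gr d"
  proof
    show "{v \<in> N. z * v \<in> I} \<subseteq> gr d"
    proof
      fix v assume "v \<in> {v \<in> N. z * v \<in> I}"
      then have v: "v \<in> forms d" "l * v \<in> I" "y * v \<in> I" "z * v \<in> I" by (auto simp: N_def ker_def)
      have "v \<in> I" by (rule soc[OF v(1)]) (rule linear_gens_mem[OF gens subspace_I v(2-4)])
      then show "v \<in> gr d" using v(1) by (simp add: gr_def)
    qed
    show "gr d \<subseteq> {v \<in> N. z * v \<in> I}"
      using I_mult_linear[OF lyz(1)] I_mult_linear[OF lyz(2)] I_mult_linear[OF lyz(3)]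
      by (auto simp: N_def gr_def ker_def)
  qed
  have y: "mp.dim ?P + mp.dim (gr (Suc d)) \<le> mp.dim N + mp.dim ?Q"
    unfolding N_def
    by (rule dim_kernel_step(1)[OF lyz(2) subspace_ker ker_subset subspace_ker ker_subset image[OF lyz(2) subset_refl]])
  note z = dim_kernel_step[OF lyz(3) N(1,3) subspace_ker ker_subset image[OF lyz(3) N(2)], unfolded final]
  show "mp.dim ?P + 2 * mp.dim (gr (Suc d)) \<le> mp.dim (gr d) + 2 * mp.dim ?Q"
    using y z(1) by linarith
  assume "mp.dim (gr d) + 2 * mp.dim ?Q \<le> mp.dim ?P + 2 * mp.dim (gr (Suc d))" and u: "u \<in> ?Q"
  then have "mp.dim (gr d) + mp.dim ?Q \<le> mp.dim N + mp.dim (gr (Suc d))" using y by linarith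
  from z(2)[OF this u] obtain v where v: "v \<in> N" "u - z * v \<in> I" by blast
  have "y * u = z * (y * v) + y * (u - z * v)" by (simp add: algebra_simps)
  moreover have "y * v \<in> I" using v(1) by (simp add: N_def)
  ultimately show "y * u \<in> I"
    using v(2) I_mult_linear[OF lyz(3)] I_mult_linear[OF lyz(2)] mp.subspace_add[OF subspace_I] by simp
qed

text \<open>Part (b) with the index shifted and subtraction removed. If it fails, both
  \<open>y\<close> and \<open>z\<close> kill \<open>ker l (Suc d)\<close>, which then consists of
  socle elements and vanishes modulo \<open>I\<close>; the first estimate of \<open>ker_step\<close>
  makes \<open>ker l d\<close> vanish too, against the drop.\<close>

lemma hilb_drop:
  assumes gens: "linear_gens l y z" and surj: "surj_at l d" "surj_at l (Suc d)"
    and soc: "\<And>e f. e \<in> {d, Suc d} \<Longrightarrow> f \<in> forms e \<Longrightarrow> (\<And>i. i < 3 \<Longrightarrow> Xvar i * f \<in> I) \<Longrightarrow> f \<in> I"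
    and drop: "hilb I (Suc d) < hilb I d"
  shows "hilb I d + 2 * hilb I (Suc (Suc d)) < 3 * hilb I (Suc d)"
proof (rule ccontr)
  note l = linear_gens_forms(1)[OF gens]
  let ?h = "hilb I"
  assume "\<not> ?thesis"
  moreover have P: "mp.dim (ker l d) + ?h (Suc d) = mp.dim (gr d) + ?h d"
    and Q: "mp.dim (ker l (Suc d)) + ?h (Suc (Suc d)) = mp.dim (gr (Suc d)) + ?h (Suc d)"
    using surj by (simp_all add: surj_at_hilb[OF l])
  ultimately have le: "mp.dim (gr d) + 2 * mp.dim (ker l (Suc d)) \<le> mp.dim (ker l d) + 2 * mp.dim (gr (Suc d))"
    by linarith
  have soc_d: "f \<in> I" if "f \<in> forms d" "\<And>i. i < 3 \<Longrightarrow> Xvar i * f \<in> I" for f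
    using soc[of d f] that by simp
  have "ker l (Suc d) \<subseteq> gr (Suc d)"
  proof
    fix u assume u: "u \<in> ker l (Suc d)"
    have "y * u \<in> I" by (rule ker_step(2)[OF gens soc_d le u])
    moreover have "z * u \<in> I" by (rule ker_step(2)[OF linear_gens_swap[OF gens] soc_d le u])
    moreover have "u \<in> forms (Suc d)" "l * u \<in> I" using u by (auto simp: ker_def)
    ultimately show "u \<in> gr (Suc d)"
      using soc[of "Suc d" u] linear_gens_mem[OF gens subspace_I] by (auto simp: gr_def)
  qed
  then have "mp.dim (ker l (Suc d)) \<le> mp.dim (gr (Suc d))"
    using gr_subset by (rule dim_forms_mono)
  moreover have "mp.dim (ker l d) + 2 * mp.dim (gr (Suc d)) \<le> mp.dim (gr d) + 2 * mp.dim (ker l (Suc d))"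
    by (rule ker_step(1)[OF gens soc_d])
  ultimately have "mp.dim (ker l d) \<le> mp.dim (gr d)" by linarith
  then show False using P drop by linarith
qed

text \<open>A form of degree \<open>d\<close> killed by all three variables lies in
  \<open>I\<close>, and passing to the kernel of each variable in turn lowers the dimension by at
  most \<open>hilb I (Suc d)\<close>.\<close>

lemma hilb_le_three_mult:
  assumes soc: "\<And>f. f \<in> forms d \<Longrightarrow> (\<And>i. i < 3 \<Longrightarrow> Xvar i * f \<in> I) \<Longrightarrow> f \<in> I"
  shows "hilb I d \<le> 3 * hilb I (Suc d)"
proof -
  let ?X = "Xvar :: nat \<Rightarrow> 'k mpoly"
  have X: "?X 0 \<in> forms 1" "?X 1 \<in> forms 1" "?X 2 \<in> forms 1" by (simp_all only: Xvar_forms)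
  define K1 where "K1 = {v \<in> forms d. ?X 0 * v \<in> I}"
  define K2 where "K2 = {v \<in> K1. ?X 1 * v \<in> I}"
  have K1: "mp.subspace K1" "K1 \<subseteq> forms d"
    unfolding K1_def using subspace_restrict[OF subspace_forms] by blast+
  have K2: "mp.subspace K2" "K2 \<subseteq> forms d"
    unfolding K2_def using subspace_restrict[OF K1(1)] K1(2) by blast+
  have step: "mp.dim V + mp.dim (gr (Suc d)) \<le> mp.dim {v \<in> V. g * v \<in> I} + mp.dim (forms (Suc d) :: 'k mpoly set)"
    if "g \<in> forms 1" "mp.subspace V" "V \<subseteq> forms d" for g V
    using that linear_mult_forms[OF that(1)] gr_subset
    by (intro dim_kernel_step(1)[OF that subspace_forms subset_refl]) blast
  have "{v \<in> K2. ?X 2 * v \<in> I} \<subseteq> gr d"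
  proof
    fix v assume v: "v \<in> {v \<in> K2. ?X 2 * v \<in> I}"
    have "?X i * v \<in> I" if "i < 3" for i
    proof -
      have "i = 0 \<or> i = 1 \<or> i = 2" using that by auto
      then show ?thesis using v unfolding K1_def K2_def by blast
    qed
    then show "v \<in> gr d" using v soc[of v] K2(2) by (auto simp: gr_def)
  qed
  then have "mp.dim {v \<in> K2. ?X 2 * v \<in> I} \<le> mp.dim (gr d)"
    using gr_subset by (rule dim_forms_mono)
  then show ?thesis
    using step[OF X(1) subspace_forms subset_refl] step[OF X(2) K1] step[OF X(3) K2]
      hilb_add_dim[of d] hilb_add_dim[of "Suc d"]
    unfolding K1_def[symmetric] K2_def[symmetric] by linarith
qed

text \<open>Surjectivity in degree \<open>r\<close> holds for general linear forms because it holds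
  for \<open>l\<close>, and growth of the Hilbert function excludes it below \<open>r\<close> for
  all of them. The value is unique because two nonempty open sets meet.\<close>

lemma r1_eqI:
  assumes l: "l \<in> forms 1" "surj_at l r" and inc: "\<And>i. i < r \<Longrightarrow> hilb I i < hilb I (Suc i)"
  shows "r1 I = r"
proof -
  obtain a0 where a0: "l = linform a0" using l(1) unfolding forms_one by blast
  have r1_at: "r1_at I (linform a) = r" if surj: "surj_at (linform a) r" for a
    unfolding r1_at_def
  proof (rule Least_equality)
    show "\<forall>p\<in>forms (Suc r). \<exists>q\<in>R3. p - linform a * q \<in> I"
      using surj forms_subset_R3 unfolding surj_at_iff[OF linform_forms] mult_surj_def by blast
  next
    fix i assume i: "\<forall>p\<in>forms (Suc i). \<exists>q\<in>R3. p - linform a * q \<in> I"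
    \<comment> \<open>The cofactor \<open>q\<close> need not be homogeneous; its component of degree
      \<open>i\<close> does the same.\<close>
    have "mult_surj I (linform a) i"
      unfolding mult_surj_def
    proof
      fix p :: "'k mpoly" assume p: "p \<in> forms (Suc i)"
      with i obtain q where q: "q \<in> R3" "p - linform a * q \<in> I" by blast
      have "hcomp (Suc i) p - hcomp (Suc i) (linform a * q) \<in> I"
        using I_hcomp[OF q(2), of "Suc i"] by (simp only: hcomp_diff)
      then have "p - linform a * hcomp i q \<in> I"
        using p hcomp_linear_mult[OF linform_forms q(1)] by (simp add: hcomp_form)
      then show "\<exists>f\<in>forms i. p - linform a * f \<in> I" using hcomp_forms[OF q(1)] by blast
    qed
    then have "hilb I (Suc i) \<le> hilb I i"
      using surj_at_hilb_le[OF linform_forms] by (simp add: surj_at_iff[OF linform_forms])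
    then show "r \<le> i" using inc[of i] by (meson leD leI)
  qed
  have "forms (Suc r) \<subseteq> mp.span ((\<lambda>f. linform a0 * f) ` forms r \<union> gr (Suc r))"
    using l(2) unfolding surj_at_def im_def a0 .
  from generic_surjectivity[OF gr_subset this]
  obtain F where F: "F \<in> R3" "F \<noteq> 0" "\<And>a. peval F a \<noteq> 0 \<Longrightarrow> r1_at I (linform a) = r"
    using r1_at unfolding surj_at_def im_def by blast
  show ?thesis
    unfolding r1_def
  proof (rule the_equality)
    show "\<exists>F\<in>R3. F \<noteq> 0 \<and> (\<forall>a. peval F a \<noteq> 0 \<longrightarrow> r1_at I (linform a) = r)" using F by blast
  next
    fix r' assume "\<exists>F\<in>R3. F \<noteq> 0 \<and> (\<forall>a. peval F a \<noteq> 0 \<longrightarrow> r1_at I (linform a) = r')"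
    then obtain G where G: "G \<in> R3" "G \<noteq> 0" "\<And>a. peval G a \<noteq> 0 \<Longrightarrow> r1_at I (linform a) = r'"
      by blast
    obtain a where a: "peval F a \<noteq> 0" "peval G a \<noteq> 0"
      by (rule peval_common_nonzero[OF F(1,2) G(1,2)])
    show "r' = r" using F(3)[OF a(1)] G(3)[OF a(2)] by simp
  qed
qed

end

section \<open>Artinian algebras of codimension three and their Lefschetz elements\<close>

locale artinian_codim3 = graded_ideal I for I :: "'k::field_char_0 mpoly set" +
  assumes art: "artinian I" and codim: "hilb I 1 = 3"
begin

text \<open>Nonvanishing in degree 1 and the bound from \<open>art\<close> show that the greatest
  degree exists.\<close>

lemma hilb_socle_degree: "hilb I (socle_degree I) \<noteq> 0"
  and hilb_above: "socle_degree I < d \<Longrightarrow> hilb I d = 0"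
proof -
  obtain N where N: "\<And>d. N \<le> d \<Longrightarrow> forms d \<subseteq> I" using art by (auto simp: artinian_def)
  have bound: "hilb I d \<noteq> 0 \<Longrightarrow> d \<le> N" for d using N[of d] hilb_eq_0_iff by (meson nat_le_linear)
  have "hilb I 1 \<noteq> 0" using codim by simp
  then show "hilb I (socle_degree I) \<noteq> 0"
    unfolding socle_degree_def by (rule GreatestI_nat) (rule bound)
  show "hilb I d = 0" if "socle_degree I < d"
  proof (rule ccontr)
    assume "hilb I d \<noteq> 0"
    then have "d \<le> socle_degree I"
      unfolding socle_degree_def by (rule Greatest_le_nat) (rule bound)
    with that show False by simp
  qed
qed

lemma hilb_below: "d \<le> socle_degree I \<Longrightarrow> hilb I d \<noteq> 0"
  using hilb_socle_degree hilb_eq_0_mono[of d "socle_degree I"] by argo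

lemma socle_degree_pos: "1 \<le> socle_degree I"
  using hilb_above[of 1] codim by (cases "socle_degree I < 1") simp_all

lemma hilb_0: "hilb I 0 = 1"
proof -
  have "hilb I 0 \<noteq> 0" using hilb_eq_0_mono[of 0 1] codim by auto
  then show ?thesis using hilb_add_dim[of 0] unfolding dim_forms_zero by simp
qed

text \<open>The value 3 is already the largest possible dimension of the space of linear
  forms.\<close>

lemma gr_1:
  assumes "g \<in> gr 1"
  shows "g = 0"
proof -
  have "mp.dim (forms 1 :: 'k mpoly set) \<le> card {Xvar 0, Xvar 1, Xvar 2 :: 'k mpoly}"
    by (rule mp.dim_le_card[OF forms_one_span]) simp
  also have "\<dots> \<le> 3" by (simp add: card_insert_if)
  finally have "mp.dim (gr 1) = 0" using hilb_add_dim[of 1] codim by linarith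
  then show ?thesis by (rule mp.dim_zero_fin[OF fin_span_subset_forms[OF gr_subset] _ assms])
qed

text \<open>\<open>WLP\<close> starts in degree 1; in degree 0 injectivity holds because
  \<open>I\<close> contains no nonzero linear form.\<close>

lemma mult_inj_0:
  assumes l: "l \<in> forms 1" "l \<noteq> 0"
  shows "mult_inj I l 0"
  unfolding mult_inj_def
proof (intro ballI impI)
  fix f assume f: "f \<in> forms 0" "l * f \<in> I"
  obtain c where c: "f = pscale c 1" using f(1) unfolding forms_zero mp.span_singleton by blast
  then have "l * f = pscale c l" by (simp add: mult_pscale_right)
  moreover have "l * f \<in> gr 1" using f linear_mult_forms[OF l(1) f(1)] by (simp add: gr_def)
  ultimately have "pscale c l = 0" using gr_1 by (simp only:)
  then have "f = 0" using c l(2) by simp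
  then show "f \<in> I" using mp.subspace_0[OF subspace_I] by simp
qed

text \<open>Extends the Lefschetz alternative to all degrees: degree 0 by \<open>mult_inj_0\<close>,
  degrees from the socle degree on because the target vanishes.\<close>

lemma lefschetz_element:
  assumes wlp: "WLP I"
  obtains l where "l \<in> forms 1" "l \<noteq> 0" "\<And>i. mult_inj I l i \<or> surj_at l i"
proof -
  let ?s = "socle_degree I"
  have high: "surj_at l i" if "?s \<le> i" "l \<in> forms 1" for l i
  proof -
    have "forms (Suc i) \<subseteq> I" using hilb_above[of "Suc i"] that(1) by (simp add: hilb_eq_0_iff)
    then have "forms (Suc i) \<subseteq> im l i" by (auto simp: im_def gr_def)
    then show ?thesis unfolding surj_at_def using mp.span_superset by blast
  qed
  show thesis
  proof (cases "?s = 1")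
    \<comment> \<open>In socle degree 1 the range of degrees in \<open>WLP\<close> is empty, so its
      linear form could be 0; a variable is taken instead.\<close>
    case True
    have "Xvar 0 \<noteq> (0 :: 'k mpoly)" by (simp add: Xvar_def) (metis lookup_single_eq lookup_zero zero_neq_one)
    moreover have "Xvar 0 \<in> (forms 1 :: 'k mpoly set)" by (rule Xvar_forms) simp
    moreover have "mult_inj I (Xvar 0) i \<or> surj_at (Xvar 0) i" for i
      using calculation mult_inj_0[of "Xvar 0"] high[of i "Xvar 0"] True by (cases i) auto
    ultimately show thesis by (intro that)
  next
    case False
    then have s2: "2 \<le> ?s" using socle_degree_pos by simp
    obtain l where l: "l \<in> forms 1" "\<And>i. 1 \<le> i \<Longrightarrow> i \<le> ?s - 1 \<Longrightarrow> mult_inj I l i \<or> mult_surj I l i"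
      using wlp unfolding WLP_def by blast
    \<comment> \<open>The zero form would force the quotient to vanish in degree 1 or 2.\<close>
    have nz: "l \<noteq> 0"
    proof
      assume "l = 0"
      moreover have "mult_inj I l 1 \<or> mult_surj I l 1" using l(2) s2 by simp
      ultimately have "forms 1 \<subseteq> I \<or> forms (Suc 1) \<subseteq> I"
        using mp.subspace_0[OF subspace_I] by (auto simp: mult_inj_def mult_surj_def)
      then have "hilb I 1 = 0 \<or> hilb I 2 = 0" unfolding hilb_eq_0_iff by (simp add: numeral_2_eq_2)
      then show False using codim hilb_below[OF s2] by auto
    qed
    have "mult_inj I l i \<or> surj_at l i" for i
    proof -
      consider "i = 0" | "1 \<le> i" "i \<le> ?s - 1" | "?s \<le> i" using s2 by linarith
      then show ?thesis
        using mult_inj_0[OF l(1) nz] l(2)[of i] surj_at_iff[OF l(1)] high[OF _ l(1)] by cases auto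
    qed
    then show thesis using l(1) nz by (intro that)
  qed
qed

end

theorem theorem3p23:
  fixes I :: "'k::field_char_0 mpoly set"
  assumes hom: "homogeneous_ideal I"
    and art: "artinian I"
    and codim: "hilb I 1 = 3"
    and lev: "level I"
    and wlp: "WLP I"
  defines "h \<equiv> hilb I"
    and "s \<equiv> socle_degree I"
    and "\<theta> \<equiv> (LEAST t. hilb I t > hilb I (Suc t))"
  shows "O_sequence h
    \<and> r1 I \<le> \<theta> \<and> \<theta> \<le> s
    \<and> (\<forall>t<r1 I. h t < h (Suc t))
    \<and> (\<forall>t. r1 I \<le> t \<and> t < \<theta> \<longrightarrow> h t = h (Suc t))
    \<and> (\<forall>t. \<theta> \<le> t \<and> t < s \<longrightarrow> h t > h (Suc t))
    \<and> O_sequence (pos_diff h)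
    \<and> (\<forall>d. \<theta> < d \<and> d < s \<longrightarrow>
          int (h (d - 1)) - int (h d) < 2 * (int (h d) - int (h (Suc d))))
    \<and> h (s - 1) \<le> 3 * h s"
proof -
  interpret artinian_codim3 I using hom art codim by unfold_locales
  obtain l where l: "l \<in> forms 1" "l \<noteq> 0" "\<And>i. mult_inj I l i \<or> surj_at l i"
    using lefschetz_element[OF wlp] by blast
  obtain y z where gens: "linear_gens l y z" using linear_gens_exist[OF l(1,2)] .
  interpret c: binary_O_sequence "cod l" by (rule cod_binary_O_sequence[OF gens])
  have soc: "f \<in> I" if "f \<in> forms d" "d \<noteq> s" "\<And>i. i < 3 \<Longrightarrow> Xvar i * f \<in> I" for f d
    using level_socle[OF lev hilb_socle_degree hilb_above[OF lessI]] that unfolding s_def by blast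
  \<comment> \<open>The drop to 0 after degree \<open>s\<close> shows that the minima defining
    \<open>r\<close> and \<theta> are attained.\<close>
  have top: "h (Suc s) < h s" using hilb_socle_degree hilb_above[of "Suc s"] by (simp add: h_def s_def)
  define r where "r = (LEAST i. h (Suc i) \<le> h i)"
  have r: "h (Suc r) \<le> h r"
    unfolding r_def using less_imp_le[OF top] by (rule LeastI)
  have inc: "h i < h (Suc i)" if "i < r" for i
    using not_less_Least[of i "\<lambda>i. h (Suc i) \<le> h i"] that by (simp add: r_def)
  \<comment> \<open>If \<open>l\<close> is injective here, it is also surjective, as the dimension
    does not grow.\<close>
  have "surj_at l r" using l(3)[of r] inj_imp_surj[OF l(1)] r by (auto simp: h_def)
  then have surj: "surj_at l i" if "r \<le> i" for i using surj_at_mono[OF l(1) _ that] by blast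
  \<comment> \<open>A surjection would contradict the growth of \<open>h\<close>.\<close>
  have inj: "mult_inj I l i" if "i < r" for i
    using l(3)[of i] surj_at_hilb_le[OF l(1), of i] inc[OF that] by (auto simp: h_def)
  have dec: "h (Suc i) \<le> h i" if "r \<le> i" for i
    unfolding h_def by (rule surj_at_hilb_le[OF l(1) surj[OF that]])
  have r1: "r1 I = r" using r1_eqI[OF l(1) \<open>surj_at l r\<close>] inc by (simp add: h_def)
  have cod_inj: "h (Suc i) = h i + cod l (Suc i)" if "i < r" for i
    using inj_at_hilb[OF l(1) inj[OF that]] hilb_add_dim[of "Suc i"] inc[OF that]
    by (simp add: cod_def h_def)
  \<comment> \<open>Beyond degree \<open>r\<close> both sides are 0: the difference is truncated and
    \<open>l\<close> is surjective.\<close>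
  have "pos_diff h i = cod l i" for i
  proof (cases i)
    case 0
    then show ?thesis by (simp add: pos_diff_def cod_def h_def hilb_0)
  next
    case (Suc j)
    show ?thesis
    proof (cases "j < r")
      case True
      then show ?thesis using cod_inj Suc by (simp add: pos_diff_def)
    next
      case False
      then have "surj_at l j" "h (Suc j) \<le> h j" using surj dec by simp_all
      then show ?thesis using Suc surj_at_dim[OF l(1)] by (simp add: pos_diff_def cod_def)
    qed
  qed
  then have "pos_diff h = cod l" by (rule ext)
  then have O_diff: "O_sequence (pos_diff h)" using c.O_seq by simp
  have O_h: "O_sequence h"
    by (rule c.O_seq_unimodal[of h r]) (simp_all add: h_def hilb_0 cod_inj[unfolded h_def] dec[unfolded h_def])
  have \<theta>: "h (Suc \<theta>) < h \<theta>"
    unfolding \<theta>_def h_def using top[unfolded h_def] by (rule LeastI)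
  have "\<theta> \<le> s" unfolding \<theta>_def using top[unfolded h_def] by (rule Least_le)
  have "r \<le> \<theta>" unfolding r_def using \<theta> by (intro Least_le) simp
  have flat: "h t = h (Suc t)" if "r \<le> t" "t < \<theta>" for t
    using dec[OF that(1)] not_less_Least[of t "\<lambda>t. hilb I (Suc t) < hilb I t"] that(2)
    by (simp add: \<theta>_def h_def)
  have drop: "h t + 2 * h (Suc (Suc t)) < 3 * h (Suc t)"
    if "\<theta> \<le> t" "Suc t < s" "h (Suc t) < h t" for t
    unfolding h_def
  proof (rule hilb_drop[OF gens])
    show "surj_at l t" "surj_at l (Suc t)" using surj that(1) \<open>r \<le> \<theta>\<close> by simp_all
    show "hilb I (Suc t) < hilb I t" using that(3) by (simp add: h_def)
    \<comment> \<open>Both degrees are below \<open>s\<close>, where the socle vanishes.\<close>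
    fix e f assume "e \<in> {t, Suc t}" "f \<in> forms e" "\<And>i. i < 3 \<Longrightarrow> Xvar i * f \<in> I"
    then show "f \<in> I" using soc[of f e] that(2) by auto
  qed
  \<comment> \<open>Each strict drop forces the next one, which by \<open>drop\<close> exceeds half
    of it.\<close>
  have strict: "h (Suc t) < h t" if "\<theta> \<le> t" "t < s" for t
    using that
  proof (induction rule: dec_induct)
    case (step n)
    then show ?case using drop[of n] by simp
  qed (rule \<theta>)
  have diff: "int (h (d - 1)) - int (h d) < 2 * (int (h d) - int (h (Suc d)))" if "\<theta> < d" "d < s" for d
  proof -
    obtain t where t: "d = Suc t" using \<open>\<theta> < d\<close> by (auto dest: less_imp_Suc_add)
    have "h t + 2 * h (Suc d) < 3 * h d"
      using drop[of t] strict[of t] \<open>\<theta> < d\<close> \<open>d < s\<close> t by simp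
    then show ?thesis using t by simp
  qed
  have "h (s - 1) \<le> 3 * h s"
  proof -
    have s: "Suc (s - 1) = s" using socle_degree_pos by (simp add: s_def)
    have "hilb I (s - 1) \<le> 3 * hilb I (Suc (s - 1))"
      using s by (intro hilb_le_three_mult) (rule soc, auto)
    then show ?thesis unfolding s h_def .
  qed
  then show ?thesis
    unfolding r1 using O_h O_diff \<open>r \<le> \<theta>\<close> \<open>\<theta> \<le> s\<close> inc flat strict diff by blast
qed

end
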